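(* Let $\mathcal{H}=(V,H)$ be a boolean representable simplicial complex of dimension $\geq 2$. Assume that the graph of flats $\Gamma\mathrm{Fl}\mathcal{H}$ has $s$ $H$-nontrivial connected components and $r$ $H$-trivial connected components, of sizes $f_1,\ldots,f_r$. Then the fundamental group $\pi_1(||\mathcal{H}||)$ of the geometric realization of $\mathcal{H}$ is a free group of rank $$\binom{s+f_1+\cdots+f_r-1}{2}-\sum_{i=1}^r\binom{f_i}{2},$$ or equivalently, $$\binom{s-1}{2}+(s-1)(f_1+\cdots+f_r)+\sum_{1\leq i<j\leq r}f_if_j.$$
   Context: A (finite) simplicial complex is a pair $\mathcal{H}=(V,H)$ where $V$ is a finite nonempty set and $H\subseteq 2^V$ contains all singletons and is closed under taking subsets; elements of $H$ are faces, the dimension of a face $I$ is $|I|-1$, and $\dim\mathcal{H}$ is the maximum dimension of a face. $P_n(V)$ denotes the set of $n$-element subsets of $V$, and $pq$ denotes $\{p,q\}$. A boolean matrix (entries $0,1$) with row set $R$ and column set $V$ is nonsingular if, after independently permuting rows and columns, it is a square lower unitriangular matrix (ones on the diagonal, zeros above it). A set $X\subseteq V$ of columns of an $R\times V$ boolean matrix $M$ is $M$-independent if there is $Y\subseteq R$ such that the submatrix $M[Y,X]$ is nonsingular. $\mathcal{H}$ is boolean representable if there is a boolean matrix $M$ such that $H$ is exactly the set of $M$-independent subsets of $V$. A subset $X\subseteq V$ is a flat of $\mathcal{H}$ if for every $I\in H$ with $I\subseteq X$ and every $p\in V\setminus X$ we have $I\cup\{p\}\in H$; $\mathrm{Fl}\mathcal{H}$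 is the set of flats, and for $X\subseteq V$, $\overline{X}$ denotes the intersection of all flats containing $X$. The graph of flats $\Gamma\mathrm{Fl}\mathcal{H}$ has vertex set $V$ and an edge $p - q$ whenever $p\neq q$ and $\overline{pq}\neq V$. A connected component $C$ of $\Gamma\mathrm{Fl}\mathcal{H}$ is $H$-trivial if $H\cap P_2(C)=\emptyset$ and $H$-nontrivial otherwise; its size is its number of vertices. $||\mathcal{H}||$ denotes the geometric realization of $\mathcal{H}$ (which is connected under the hypotheses). *)

theory Defs
  imports
    "HOL-Analysis.Analysis"
    "HOL-Algebra.Group"
    "HOL-Library.Ramsey"
begin

section \<open>Simplicial complexes and boolean representability\<close>

text \<open>A complex is given by its vertex set and its set of faces; the empty set is a face.\<close>

definition abstract_complex :: "'a set \<Rightarrow> 'a set set \<Rightarrow> bool" where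
  "abstract_complex V H \<longleftrightarrow>
     finite V \<and> V \<noteq> {} \<and> H \<subseteq> Pow V \<and> (\<forall>v\<in>V. {v} \<in> H) \<and> (\<forall>I\<in>H. \<forall>J\<subseteq>I. J \<in> H)"

definition complex_dim :: "'a set set \<Rightarrow> int" where
  "complex_dim H = Max ((\<lambda>I. int (card I) - 1) ` H)"

text \<open>The entry 1 is \<open>True\<close>. The bijections \<open>y\<close> and \<open>x\<close> order the rows \<open>Y\<close> and the columns \<open>X\<close>.\<close>

definition nonsingular_submatrix :: "('r \<Rightarrow> 'a \<Rightarrow> bool) \<Rightarrow> 'r set \<Rightarrow> 'a set \<Rightarrow> bool" where
  "nonsingular_submatrix M Y X \<longleftrightarrow>
     (\<exists>(n::nat) y x. bij_betw y {..<n} Y \<and> bij_betw x {..<n} X \<and>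
        (\<forall>i<n. M (y i) (x i)) \<and> (\<forall>j<n. \<forall>i<j. \<not> M (y i) (x j)))"

definition matrix_independent :: "'r set \<Rightarrow> ('r \<Rightarrow> 'a \<Rightarrow> bool) \<Rightarrow> 'a set \<Rightarrow> bool" where
  "matrix_independent R M X \<longleftrightarrow> (\<exists>Y\<subseteq>R. nonsingular_submatrix M Y X)"

text \<open>Matrices are finite, so their rows can be labelled by natural numbers.\<close>

definition boolean_representable :: "'a set \<Rightarrow> 'a set set \<Rightarrow> bool" where
  "boolean_representable V H \<longleftrightarrow>
     (\<exists>(R::nat set) M. finite R \<and> H = {X. X \<subseteq> V \<and> matrix_independent R M X})"


section \<open>Flats and the graph of flats\<close>

definition flats :: "'a set \<Rightarrow> 'a set set \<Rightarrow> 'a set set" where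
  "flats V H = {X. X \<subseteq> V \<and> (\<forall>I\<in>H. I \<subseteq> X \<longrightarrow> (\<forall>p\<in>V - X. I \<union> {p} \<in> H))}"

definition flat_closure :: "'a set \<Rightarrow> 'a set set \<Rightarrow> 'a set \<Rightarrow> 'a set" where
  "flat_closure V H X = \<Inter>{F \<in> flats V H. X \<subseteq> F}"

definition flat_graph_edges :: "'a set \<Rightarrow> 'a set set \<Rightarrow> ('a \<times> 'a) set" where
  "flat_graph_edges V H =
     {(p, q). p \<in> V \<and> q \<in> V \<and> p \<noteq> q \<and> flat_closure V H {p, q} \<noteq> V}"

lemma sym_flat_graph_edges: "sym (flat_graph_edges V H)"
  by (auto simp: sym_def flat_graph_edges_def insert_commute)

definition flat_graph_components :: "'a set \<Rightarrow> 'a set set \<Rightarrow> 'a set set" where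
  "flat_graph_components V H = V // {(p, q). p \<in> V \<and> q \<in> V \<and> (p, q) \<in> (flat_graph_edges V H)\<^sup>*}"

lemma equiv_flat_graph_reachability:
  "equiv V {(p, q). p \<in> V \<and> q \<in> V \<and> (p, q) \<in> (flat_graph_edges V H)\<^sup>*}"
proof (rule equivI)
  show "sym {(p, q). p \<in> V \<and> q \<in> V \<and> (p, q) \<in> (flat_graph_edges V H)\<^sup>*}"
    using sym_rtrancl[OF sym_flat_graph_edges[of V H]] by (simp add: sym_def)
  show "trans {(p, q). p \<in> V \<and> q \<in> V \<and> (p, q) \<in> (flat_graph_edges V H)\<^sup>*}"
    unfolding trans_def using rtrancl_trans[of _ _ "flat_graph_edges V H"] by blast
qed (auto simp: refl_on_def)

definition trivial_components :: "'a set \<Rightarrow> 'a set set \<Rightarrow> 'a set set" where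
  "trivial_components V H = {C \<in> flat_graph_components V H. H \<inter> nsets C 2 = {}}"

definition nontrivial_components :: "'a set \<Rightarrow> 'a set set \<Rightarrow> 'a set set" where
  "nontrivial_components V H = {C \<in> flat_graph_components V H. H \<inter> nsets C 2 \<noteq> {}}"


section \<open>Geometric realization\<close>

text \<open>Points are given by their barycentric coordinates; the topology is the subspace topology
  of the product topology on \<open>'a \<Rightarrow> real\<close>. As \<open>{v. x v \<noteq> 0} \<in> H\<close>, coordinates outside \<open>V\<close> vanish.\<close>

definition geometric_realization :: "'a set \<Rightarrow> 'a set set \<Rightarrow> ('a \<Rightarrow> real) set" where
  "geometric_realization V H = {x. (\<forall>v. 0 \<le> x v) \<and> {v. x v \<noteq> 0} \<in> H \<and> (\<Sum>v\<in>V. x v) = 1}"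


section \<open>The fundamental group\<close>

definition loops_at :: "'b::topological_space set \<Rightarrow> 'b \<Rightarrow> (real \<Rightarrow> 'b) set" where
  "loops_at S x = {p. path p \<and> path_image p \<subseteq> S \<and> pathstart p = x \<and> pathfinish p = x}"

definition loop_class :: "'b::topological_space set \<Rightarrow> (real \<Rightarrow> 'b) \<Rightarrow> (real \<Rightarrow> 'b) set" where
  "loop_class S p = {q. homotopic_paths S p q}"

definition fundamental_group :: "'b::topological_space set \<Rightarrow> 'b \<Rightarrow> (real \<Rightarrow> 'b) set monoid" where
  "fundamental_group S x =
     \<lparr>carrier = loop_class S ` loops_at S x,
      monoid.mult = (\<lambda>P Q. \<Union>p\<in>P. \<Union>q\<in>Q. loop_class S (p +++ q)),
      one = loop_class S (\<lambda>_. x)\<rparr>"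


lemma loop_class_cong:
  assumes "homotopic_paths S p q"
  shows "loop_class S p = loop_class S q"
proof -
  have "homotopic_paths S p r \<longleftrightarrow> homotopic_paths S q r" for r
    using homotopic_paths_trans[OF assms, of r]
      homotopic_paths_trans[OF homotopic_paths_sym[OF assms], of r] by blast
  then show ?thesis
    by (simp add: loop_class_def)
qed

lemma loop_class_eq_iff:
  assumes "p \<in> loops_at S x"
  shows "loop_class S p = loop_class S q \<longleftrightarrow> homotopic_paths S p q"
proof
  assume "loop_class S p = loop_class S q"
  moreover have "p \<in> loop_class S p"
    using assms by (simp add: loop_class_def loops_at_def)
  ultimately show "homotopic_paths S p q"
    by (simp add: loop_class_def homotopic_paths_sym)
qed (rule loop_class_cong)

lemma fundamental_group_mult:
  assumes "p \<in> loops_at S x" "q \<in> loops_at S x"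
  shows "loop_class S p \<otimes>\<^bsub>fundamental_group S x\<^esub> loop_class S q = loop_class S (p +++ q)"
proof -
  have "loop_class S (p' +++ q') = loop_class S (p +++ q)"
    if "p' \<in> loop_class S p" "q' \<in> loop_class S q" for p' q'
  proof -
    have "homotopic_paths S (p +++ q) (p' +++ q')"
      using that assms by (intro homotopic_paths_join) (simp_all add: loop_class_def loops_at_def)
    then show ?thesis
      by (rule loop_class_cong[symmetric])
  qed
  then have "(\<Union>p'\<in>loop_class S p. \<Union>q'\<in>loop_class S q. loop_class S (p' +++ q'))
      = (\<Union>p'\<in>loop_class S p. \<Union>q'\<in>loop_class S q. loop_class S (p +++ q))"
    by (intro SUP_cong refl)
  moreover have "loop_class S p \<noteq> {}" "loop_class S q \<noteq> {}"
    using assms by (auto simp: loop_class_def loops_at_def intro: homotopic_paths_refl[THEN iffD2])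
  ultimately show ?thesis
    by (simp add: fundamental_group_def)
qed

lemma loops_at_join: "p \<in> loops_at S x \<Longrightarrow> q \<in> loops_at S x \<Longrightarrow> p +++ q \<in> loops_at S x"
  by (auto simp: loops_at_def path_image_join)

lemma loops_at_const: "x \<in> S \<Longrightarrow> (\<lambda>_. x) \<in> loops_at S x"
  by (auto simp: loops_at_def path_def path_image_def pathstart_def pathfinish_def)

lemma loops_at_reversepath: "p \<in> loops_at S x \<Longrightarrow> reversepath p \<in> loops_at S x"
  by (auto simp: loops_at_def)

lemma homotopic_paths_const_join:
  assumes "p \<in> loops_at S x"
  shows "homotopic_paths S ((\<lambda>_. x) +++ p) p"
proof -
  have "homotopic_paths S p ((\<lambda>_. x) +++ p)"
  proof (rule homotopic_paths_reparametrize[where f = "\<lambda>t. max 0 (2 * t - 1)"])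
    show "((\<lambda>_. x) +++ p) t = p (max 0 (2 * t - 1))" if "t \<in> {0..1}" for t
    proof -
      have "max 0 (2 * t - 1) = (if t \<le> 1/2 then 0 else 2 * t - 1)" by simp
      then show ?thesis using assms by (simp add: loops_at_def joinpaths_def pathstart_def)
    qed
  qed (use assms in \<open>auto simp: loops_at_def intro!: continuous_intros\<close>)
  then show ?thesis
    by (rule homotopic_paths_sym)
qed

lemma homotopic_paths_reversepath_join:
  assumes "p \<in> loops_at S x"
  shows "homotopic_paths S (reversepath p +++ p) (\<lambda>_. x)"
proof -
  define q where "q = reversepath p"
  have q: "q \<in> loops_at S x" and p: "p = reversepath q"
    using assms by (auto simp: q_def loops_at_reversepath)
  then have cont: "continuous_on {0..1} q" and img: "q ` {0..1} \<subseteq> S"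
    and ends: "q 0 = x" "q 1 = x"
    by (auto simp: loops_at_def path_def path_image_def pathstart_def pathfinish_def)
  define h where "h = (\<lambda>y::real \<times> real. q (fst y * (1 - \<bar>2 * snd y - 1\<bar>)))"
  have range: "a * (1 - \<bar>2 * b - 1\<bar>) \<in> {0..1}" if "a \<in> {0..1}" "b \<in> {0..1}" for a b :: real
    using that by (auto intro!: mult_nonneg_nonneg mult_le_one)
  have "continuous_on ({0..1} \<times> {0..1}) h"
    unfolding h_def
    by (rule continuous_on_compose2[OF cont]) (use range in \<open>auto intro!: continuous_intros\<close>)
  moreover have "h \<in> ({0..1} \<times> {0..1}) \<rightarrow> S"
    using img range by (auto simp: h_def image_subset_iff)
  moreover have "h (1, t) = (q +++ p) t" if "t \<in> {0..1}" for t
  proof (cases "t \<le> 1/2")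
    case True
    then have "1 - \<bar>2 * t - 1\<bar> = 2 * t" by simp
    then show ?thesis using True by (simp add: h_def joinpaths_def)
  next
    case False
    then have "1 - \<bar>2 * t - 1\<bar> = 1 - (2 * t - 1)" by simp
    then show ?thesis using False by (simp add: h_def joinpaths_def p reversepath_def)
  qed
  ultimately have "homotopic_paths S (\<lambda>_. x) (q +++ p)"
    unfolding homotopic_paths using ends
    by (intro exI[of _ h])
       (auto simp: h_def pathstart_def pathfinish_def joinpaths_def p reversepath_def)
  then show ?thesis
    unfolding q_def by (rule homotopic_paths_sym)
qed

lemma group_fundamental_group:
  assumes "x \<in> S"
  shows "group (fundamental_group S x)"
proof (rule groupI)
  let ?G = "fundamental_group S x"
  have carrier: "carrier ?G = loop_class S ` loops_at S x"
    and one: "\<one>\<^bsub>?G\<^esub> = loop_class S (\<lambda>_. x)"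
    by (simp_all add: fundamental_group_def)
  note defs = carrier one fundamental_group_mult loops_at_join loops_at_const[OF assms]
  show "P \<otimes>\<^bsub>?G\<^esub> Q \<in> carrier ?G" if "P \<in> carrier ?G" "Q \<in> carrier ?G" for P Q
    using that by (auto simp: defs)
  show "\<one>\<^bsub>?G\<^esub> \<in> carrier ?G"
    by (auto simp: defs)
  show "P \<otimes>\<^bsub>?G\<^esub> Q \<otimes>\<^bsub>?G\<^esub> R = P \<otimes>\<^bsub>?G\<^esub> (Q \<otimes>\<^bsub>?G\<^esub> R)"
    if "P \<in> carrier ?G" "Q \<in> carrier ?G" "R \<in> carrier ?G" for P Q R
  proof -
    obtain p q r where pqr: "p \<in> loops_at S x" "q \<in> loops_at S x" "r \<in> loops_at S x"
      and "P = loop_class S p" "Q = loop_class S q" "R = loop_class S r"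
      using \<open>P \<in> _\<close> \<open>Q \<in> _\<close> \<open>R \<in> _\<close> by (auto simp: carrier)
    moreover have "homotopic_paths S (p +++ q +++ r) ((p +++ q) +++ r)"
      using pqr by (intro homotopic_paths_assoc) (auto simp: loops_at_def)
    ultimately show ?thesis
      by (simp add: defs loop_class_eq_iff[of _ S x] homotopic_paths_sym)
  qed
  show "\<one>\<^bsub>?G\<^esub> \<otimes>\<^bsub>?G\<^esub> P = P" if "P \<in> carrier ?G" for P
  proof -
    obtain p where p: "p \<in> loops_at S x" "P = loop_class S p"
      using \<open>P \<in> carrier ?G\<close> by (auto simp: carrier)
    have "loop_class S ((\<lambda>_. x) +++ p) = loop_class S p"
      using p homotopic_paths_const_join[OF p(1)]
      by (simp add: loop_class_eq_iff[of _ S x] loops_at_join loops_at_const[OF assms])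
    then show ?thesis
      using p by (simp add: defs)
  qed
  show "\<exists>Q\<in>carrier ?G. Q \<otimes>\<^bsub>?G\<^esub> P = \<one>\<^bsub>?G\<^esub>" if "P \<in> carrier ?G" for P
  proof -
    obtain p where p: "p \<in> loops_at S x" "P = loop_class S p"
      using \<open>P \<in> carrier ?G\<close> by (auto simp: carrier)
    have "loop_class S (reversepath p) \<otimes>\<^bsub>?G\<^esub> P = \<one>\<^bsub>?G\<^esub>"
      using p homotopic_paths_reversepath_join[OF p(1)]
      by (simp add: defs loops_at_reversepath loop_class_eq_iff[of _ S x])
    then show ?thesis
      using loops_at_reversepath[OF p(1)] by (auto simp: carrier)
  qed
qed


section \<open>Free groups\<close>

text \<open>The letter \<open>(a, True)\<close> stands for the generator \<open>a\<close> and \<open>(a, False)\<close> for its inverse.\<close>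

type_synonym 'g word = "('g \<times> bool) list"

definition letter_inv :: "'g \<times> bool \<Rightarrow> 'g \<times> bool" where
  "letter_inv g = (fst g, \<not> snd g)"

definition reduced_word :: "'g word \<Rightarrow> bool" where
  "reduced_word w \<longleftrightarrow> (\<forall>i. Suc i < length w \<longrightarrow> w ! Suc i \<noteq> letter_inv (w ! i))"

fun reduced_cons :: "'g \<times> bool \<Rightarrow> 'g word \<Rightarrow> 'g word" where
  "reduced_cons g [] = [g]"
| "reduced_cons g (h # w) = (if h = letter_inv g then w else g # h # w)"

text \<open>For reduced \<open>u\<close> and \<open>v\<close>, \<open>foldr reduced_cons u v\<close> is the reduced form of \<open>u @ v\<close>.\<close>

definition free_group :: "'g set \<Rightarrow> 'g word monoid" where
  "free_group X =
     \<lparr>carrier = {w. reduced_word w \<and> fst ` set w \<subseteq> X},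
      monoid.mult = foldr reduced_cons,
      one = []\<rparr>"

lemma reduced_Cons:
  "reduced_word (g # w) \<longleftrightarrow> reduced_word w \<and> (w \<noteq> [] \<longrightarrow> hd w \<noteq> letter_inv g)"
proof (cases w)
  case (Cons h u)
  show ?thesis
    unfolding reduced_word_def Cons by (auto simp: nth_Cons split: nat.splits)
qed (simp add: reduced_word_def)

lemma letter_inv_letter_inv [simp]: "letter_inv (letter_inv g) = g"
  by (simp add: letter_inv_def)

lemma reduced_reduced_cons: "reduced_word w \<Longrightarrow> reduced_word (reduced_cons g w)"
  by (cases w) (auto simp: reduced_Cons reduced_word_def[of "[]"])

lemma reduced_foldr: "reduced_word v \<Longrightarrow> reduced_word (foldr reduced_cons u v)"
  by (induction u) (auto simp: reduced_reduced_cons)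

lemma reduced_cons_cancel: "reduced_word w \<Longrightarrow> reduced_cons g (reduced_cons (letter_inv g) w) = w"
  by (cases w rule: list.exhaust; cases "tl w") (auto simp: reduced_Cons)

lemma foldr_reduced_cons:
  assumes "reduced_word w"
  shows "foldr reduced_cons (reduced_cons g v) w = reduced_cons g (foldr reduced_cons v w)"
  using assms by (cases v) (auto simp: reduced_cons_cancel reduced_foldr)

lemma foldr_reduced_cons_assoc:
  assumes "reduced_word w"
  shows "foldr reduced_cons (foldr reduced_cons u v) w = foldr reduced_cons u (foldr reduced_cons v w)"
  using assms by (induction u) (auto simp: foldr_reduced_cons)

lemma foldr_reduced_cons_id: "reduced_word u \<Longrightarrow> foldr reduced_cons u [] = u"
proof (induction u)
  case (Cons g u)
  then show ?case by (cases u) (auto simp: reduced_Cons)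
qed simp

lemma set_reduced_cons: "set (reduced_cons g w) \<subseteq> insert g (set w)"
  by (cases w) auto

lemma set_foldr_reduced_cons: "set (foldr reduced_cons u v) \<subseteq> set u \<union> set v"
proof (induction u)
  case (Cons g u)
  then show ?case
    using set_reduced_cons[of g "foldr reduced_cons u v"] by auto
qed simp

lemma foldr_reduced_cons_left_inverse:
  "\<exists>v. fst ` set v = fst ` set u \<and> reduced_word v \<and> foldr reduced_cons v u = []"
  if "reduced_word u" for u :: "'g word"
proof -
  define v where "v = rev (map letter_inv u)"
  have "foldr reduced_cons (rev (map letter_inv t)) (t @ z) = z" if "reduced_word (t @ z)" for t z :: "'g word"
    using that
  proof (induction t)
    case (Cons g t)
    have "reduced_cons (letter_inv g) (g # t @ z) = t @ z" by simp
    then show ?case using Cons by (simp add: reduced_Cons)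
  qed simp
  from this[of u "[]"] have "foldr reduced_cons v u = []"
    using that by (simp add: v_def)
  moreover have "fst ` set v = fst ` set u"
    by (simp add: v_def image_image letter_inv_def)
  moreover have "reduced_word v"
    unfolding reduced_word_def
  proof (intro allI impI notI)
    fix i assume i: "Suc i < length v" and eq: "v ! Suc i = letter_inv (v ! i)"
    define j where "j = length u - Suc (Suc i)"
    have j: "Suc j < length u" "length u - Suc i = Suc j"
      using i by (auto simp: v_def j_def)
    have "v ! i = letter_inv (u ! Suc j)" "v ! Suc i = letter_inv (u ! j)"
      using i j by (auto simp: v_def rev_nth j_def)
    then have "u ! Suc j = letter_inv (u ! j)"
      using eq by simp
    then show False
      using \<open>reduced_word u\<close> j(1) by (auto simp: reduced_word_def)
  qed
  ultimately show ?thesis by blast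
qed

lemma group_free_group: "group (free_group X)"
proof (rule groupI)
  fix u v w assume u: "u \<in> carrier (free_group X)"
  obtain u' where "fst ` set u' = fst ` set u" "reduced_word u'" "foldr reduced_cons u' u = []"
    using u foldr_reduced_cons_left_inverse[of u] by (auto simp: free_group_def)
  then show "\<exists>v\<in>carrier (free_group X). v \<otimes>\<^bsub>free_group X\<^esub> u = \<one>\<^bsub>free_group X\<^esub>"
    using u by (intro bexI[of _ u']) (simp_all add: free_group_def)
  assume v: "v \<in> carrier (free_group X)"
  have "fst ` set (foldr reduced_cons u v) \<subseteq> fst ` set u \<union> fst ` set v"
    using image_mono[OF set_foldr_reduced_cons] by (simp flip: image_Un)
  also have "\<dots> \<subseteq> X"
    using u v by (simp add: free_group_def)
  finally show "u \<otimes>\<^bsub>free_group X\<^esub> v \<in> carrier (free_group X)"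
    using v by (simp add: free_group_def reduced_foldr)
  assume w: "w \<in> carrier (free_group X)"
  then show "u \<otimes>\<^bsub>free_group X\<^esub> v \<otimes>\<^bsub>free_group X\<^esub> w
      = u \<otimes>\<^bsub>free_group X\<^esub> (v \<otimes>\<^bsub>free_group X\<^esub> w)"
    by (simp add: free_group_def foldr_reduced_cons_assoc)
next
  show "\<one>\<^bsub>free_group X\<^esub> \<in> carrier (free_group X)"
    by (simp add: free_group_def reduced_word_def)
qed (simp add: free_group_def)

definition free_of_rank :: "('b, 'c) monoid_scheme \<Rightarrow> nat \<Rightarrow> bool" where
  "free_of_rank G n \<longleftrightarrow> G \<cong> free_group {..<n}"

end

theory Submission
  imports Defs "HOL-Algebra.Coset"
begin

text \<open>A path in the realization runs through finitely many open vertex stars, and a group-valued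
  function on edges that is multiplicative on faces (a cocycle) therefore has a holonomy along it,
  which depends only on its homotopy class. Conversely, a loop is determined up to homotopy by the
  sequence of stars, since paths inside one star contract to its centre. So the fundamental group is
  the edge-path group, and it remains to normalise an arbitrary cocycle \<open>c\<close> on the complex.

  Boolean representability enters only through the fact that every nonempty face \<open>X\<close> has a
  vertex \<open>y\<close> such that a flat contains \<open>X - {y}\<close> but not \<open>y\<close>. Hence two
  vertices of a triangle always lie in a common proper flat, and an edge inside a proper flat can be
  coned off from any vertex outside it. Coning shows that \<open>c\<close> is a coboundary on each
  nontrivial component, and that \<open>c u v\<close> for \<open>u\<close>, \<open>v\<close> in different
  components depends, after a change of gauge, only on the contracted graph in which every nontrivial
  component is a point. This graph has a spanning star centred at a nontrivial component, and the
  remaining edges are free generators.\<close>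

section \<open>Homotopies of paths\<close>

text \<open>Two cocycles on the same complex are compared. The tautological one takes values in the
  fundamental group itself, and its holonomy around a loop is, up to conjugation, the class of that
  loop. The other takes values in the free group on the edges outside the star; its triangle law
  holds because two vertices of every triangle share a component, so that contraction leaves only a
  graph. Freeness gives a homomorphism \<open>h\<close> out of the free group, and the normal form
  of the tautological cocycle says that \<open>h\<close> carries the second cocycle to the first up
  to gauge. A loop with trivial holonomy in the free group is therefore null-homotopic, which
  replaces a presentation of the fundamental group. The obstacle is that two vertices of a
  nontrivial component may be parallel, that is, span no face, so gauge values have to be carried
  around such pairs. The rank is an edge count: vertices in different components always span a face,
  distinct vertices of a trivial component never do, so the missing edges are the pairs inside
  trivial components.\<close>

lemma homotopic_paths_image_triangle:
  fixes C :: "'b::real_normed_vector set"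
  assumes "convex C" "a \<in> C" "b \<in> C" "c \<in> C" "continuous_on C h" "h \<in> C \<rightarrow> S"
  shows "homotopic_paths S ((h \<circ> linepath a b) +++ (h \<circ> linepath b c)) (h \<circ> linepath a c)"
proof -
  have "homotopic_paths C (linepath a b +++ linepath b c) (linepath a c)"
  proof (rule homotopic_paths_linear)
    fix t :: real
    assume t: "t \<in> {0..1}"
    have "path_image (linepath a b +++ linepath b c) \<subseteq> C" "path_image (linepath a c) \<subseteq> C"
      using assms by (auto simp: path_image_join closed_segment_subset)
    then have "(linepath a b +++ linepath b c) t \<in> C" "linepath a c t \<in> C"
      using t by (auto simp: path_image_def)
    then show "closed_segment ((linepath a b +++ linepath b c) t) (linepath a c t) \<subseteq> C"
      using \<open>convex C\<close> by (rule closed_segment_subset)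
  qed auto
  from homotopic_paths_continuous_image[OF this assms(5,6)] show ?thesis
    by (simp add: path_compose_join)
qed

definition path_between :: "'b::topological_space set \<Rightarrow> 'b \<Rightarrow> 'b \<Rightarrow> (real \<Rightarrow> 'b) \<Rightarrow> bool" where
  "path_between S y z p \<longleftrightarrow> path p \<and> path_image p \<subseteq> S \<and> pathstart p = y \<and> pathfinish p = z"

lemma path_between_join:
  "path_between S u v p \<Longrightarrow> path_between S v w q \<Longrightarrow> path_between S u w (p +++ q)"
  by (auto simp: path_between_def path_image_join)

lemma path_between_reversepath:
  "path_between S u v p \<Longrightarrow> path_between S v u (reversepath p)"
  by (auto simp: path_between_def)

lemma path_between_const: "u \<in> S \<Longrightarrow> path_between S u u (\<lambda>_. u)"
  using loops_at_const[of u S] by (auto simp: path_between_def loops_at_def)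

lemma path_between_ends: "path_between S u v p \<Longrightarrow> u \<in> S \<and> v \<in> S"
  by (auto simp: path_between_def)

lemma loops_at_path_between: "p \<in> loops_at S x \<longleftrightarrow> path_between S x x p"
  by (auto simp: path_between_def loops_at_def)

lemma path_compose_linepath:
  assumes "path p" "path_image p \<subseteq> S" "a \<in> {0..1}" "b \<in> {0..1}"
  shows "path_between S (p a) (p b) (p \<circ> linepath a b)"
  unfolding path_between_def
proof (intro conjI)
  have sub: "closed_segment a b \<subseteq> {0..1}"
    using assms(3,4) by (rule closed_segment_subset) auto
  show "path (p \<circ> linepath a b)"
    using assms(1) sub by (intro path_continuous_image) (auto simp: path_def intro: continuous_on_subset)
  show "path_image (p \<circ> linepath a b) \<subseteq> S"
    using assms(2) sub by (auto simp: path_image_compose path_image_def[of p])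
qed (auto simp: pathstart_compose pathfinish_compose)

text \<open>On the real line \<open>linepath\<close> reparametrizes and may run backwards, so the
  parameters \<open>0, 0, 1\<close> give the unit law below and \<open>0, 1, 0\<close> the inverse
  law.\<close>

lemma homotopic_paths_linepath_join:
  assumes "path p" "path_image p \<subseteq> S" "a \<in> {0..1}" "b \<in> {0..1}" "c \<in> {0..1}"
  shows "homotopic_paths S ((p \<circ> linepath a b) +++ (p \<circ> linepath b c)) (p \<circ> linepath a c)"
  using assms by (intro homotopic_paths_image_triangle[of "{0..1}"]) (auto simp: path_def path_image_def)

lemma linepath_real_01: "p \<circ> linepath 0 1 = (p :: real \<Rightarrow> 'b)"
  by (auto simp: fun_eq_iff linepath_def)

lemma homotopic_paths_left_const:
  assumes "path_between S u v p"
  shows "homotopic_paths S ((\<lambda>_. u) +++ p) p"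
proof -
  have "p 0 = u" using assms by (auto simp: path_between_def pathstart_def)
  then show ?thesis
    using homotopic_paths_linepath_join[of p S 0 0 1] assms
    by (simp add: path_between_def linepath_real_01 linepath_refl o_def)
qed

lemma homotopic_paths_join_reversepath:
  assumes "path_between S u v p"
  shows "homotopic_paths S (p +++ reversepath p) (\<lambda>_. u)"
proof -
  have "p 0 = u" using assms by (auto simp: path_between_def pathstart_def)
  moreover have "p \<circ> linepath 1 0 = reversepath p"
    by (auto simp: fun_eq_iff reversepath_def linepath_def)
  ultimately show ?thesis
    using homotopic_paths_linepath_join[of p S 0 1 0] assms
    by (simp add: path_between_def linepath_real_01 linepath_refl o_def)
qed

lemma homotopic_paths_cancel_middle:
  assumes "path_between S u v p" "path_between S w v t" "path_between S v z q"
  shows "homotopic_paths S ((p +++ reversepath t) +++ (t +++ q)) (p +++ q)"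
proof -
  note d = path_between_def
  have "homotopic_paths S (p +++ (reversepath t +++ (t +++ q))) ((p +++ reversepath t) +++ (t +++ q))"
    using assms by (intro homotopic_paths_assoc) (auto simp: d path_image_join)
  moreover have "homotopic_paths S (reversepath t +++ (t +++ q)) ((reversepath t +++ t) +++ q)"
    using assms by (intro homotopic_paths_assoc) (auto simp: d)
  moreover have "homotopic_paths S ((reversepath t +++ t) +++ q) ((\<lambda>_. v) +++ q)"
    using homotopic_paths_join_reversepath[of S v w "reversepath t"] assms
    by (intro homotopic_paths_join) (auto simp: d)
  moreover have "homotopic_paths S ((\<lambda>_. v) +++ q) q"
    using assms homotopic_paths_left_const by blast
  ultimately have "homotopic_paths S (reversepath t +++ (t +++ q)) q"
    using homotopic_paths_trans by blast
  then have "homotopic_paths S (p +++ (reversepath t +++ (t +++ q))) (p +++ q)"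
    using assms by (intro homotopic_paths_join) (auto simp: d)
  then show ?thesis
    using \<open>homotopic_paths S (p +++ (reversepath t +++ (t +++ q))) ((p +++ reversepath t) +++ (t +++ q))\<close>
    using homotopic_paths_trans homotopic_paths_sym by blast
qed

section \<open>The fundamental groupoid folded into one group\<close>

locale based_space =
  fixes S :: "'b::topological_space set" and x :: 'b and \<tau> :: "'b \<Rightarrow> real \<Rightarrow> 'b"
  assumes connect: "y \<in> S \<Longrightarrow> path_between S x y (\<tau> y)"
    and x: "x \<in> S"
begin

sublocale pi1: group "fundamental_group S x"
  using x by (rule group_fundamental_group)

text \<open>Closing up paths along \<open>\<tau>\<close> maps the fundamental groupoid to a single group, so that
  identities between path classes can be computed there.\<close>

definition \<Theta> :: "(real \<Rightarrow> 'b) \<Rightarrow> (real \<Rightarrow> 'b) set" where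
  "\<Theta> p = loop_class S ((\<tau> (pathstart p) +++ p) +++ reversepath (\<tau> (pathfinish p)))"

lemma \<Theta>_loop:
  assumes "path_between S y z p"
  shows "(\<tau> y +++ p) +++ reversepath (\<tau> z) \<in> loops_at S x"
proof -
  have "path_between S x y (\<tau> y)" "path_between S x z (\<tau> z)"
    using connect path_between_ends[OF assms] by auto
  then show ?thesis
    unfolding loops_at_path_between using assms
    by (intro path_between_join[of S x z] path_between_join[of S x y] path_between_reversepath)
qed

lemma \<Theta>_carrier: "path_between S y z p \<Longrightarrow> \<Theta> p \<in> carrier (fundamental_group S x)"
  using \<Theta>_loop[of y z p] by (auto simp: \<Theta>_def fundamental_group_def path_between_def)

lemma \<Theta>_cong:
  assumes "homotopic_paths S p q"
  shows "\<Theta> p = \<Theta> q"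
proof -
  let ?y = "pathstart p" and ?z = "pathfinish p"
  have pq: "path_between S ?y ?z p"
    using homotopic_paths_imp_path[OF assms] homotopic_paths_imp_subset[OF assms] by (simp add: path_between_def)
  have "path_between S x ?y (\<tau> ?y)" "path_between S x ?z (\<tau> ?z)"
    using connect path_between_ends[OF pq] by auto
  then have "homotopic_paths S ((\<tau> ?y +++ p) +++ reversepath (\<tau> ?z)) ((\<tau> ?y +++ q) +++ reversepath (\<tau> ?z))"
    using assms pq by (intro homotopic_paths_join) (auto simp: path_between_def)
  then show ?thesis
    using homotopic_paths_imp_pathstart[OF assms] homotopic_paths_imp_pathfinish[OF assms]
    by (simp add: \<Theta>_def loop_class_cong)
qed

lemma \<Theta>_join:
  assumes p: "path_between S y z p" and q: "path_between S z w q"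
  shows "\<Theta> (p +++ q) = \<Theta> p \<otimes>\<^bsub>fundamental_group S x\<^esub> \<Theta> q"
proof -
  have y: "path_between S x y (\<tau> y)" and z: "path_between S x z (\<tau> z)" and w: "path_between S x w (\<tau> w)"
    using connect path_between_ends[OF p] path_between_ends[OF q] by auto
  have 1: "homotopic_paths S (((\<tau> y +++ p) +++ reversepath (\<tau> z)) +++ (\<tau> z +++ (q +++ reversepath (\<tau> w))))
     ((\<tau> y +++ p) +++ (q +++ reversepath (\<tau> w)))"
    using p q y z w
    by (intro homotopic_paths_cancel_middle[of S x z _ x _ x] path_between_join[of S x y]
        path_between_join[of S z w] path_between_reversepath)
  have 2: "homotopic_paths S ((\<tau> y +++ p) +++ (q +++ reversepath (\<tau> w))) (((\<tau> y +++ p) +++ q) +++ reversepath (\<tau> w))"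
    using p q y z w by (intro homotopic_paths_assoc) (auto simp: path_between_def path_image_join)
  have 3: "homotopic_paths S (((\<tau> y +++ p) +++ q) +++ reversepath (\<tau> w)) ((\<tau> y +++ (p +++ q)) +++ reversepath (\<tau> w))"
    using p q y z w
    by (intro homotopic_paths_join homotopic_paths_sym[OF homotopic_paths_assoc]) (auto simp: path_between_def path_image_join)
  have 4: "homotopic_paths S (\<tau> z +++ (q +++ reversepath (\<tau> w))) ((\<tau> z +++ q) +++ reversepath (\<tau> w))"
    using p q y z w by (intro homotopic_paths_assoc) (auto simp: path_between_def path_image_join)
  have 5: "homotopic_paths S (((\<tau> y +++ p) +++ reversepath (\<tau> z)) +++ ((\<tau> z +++ q) +++ reversepath (\<tau> w)))
     (((\<tau> y +++ p) +++ reversepath (\<tau> z)) +++ (\<tau> z +++ (q +++ reversepath (\<tau> w))))"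
    using p q y z w 4
    by (intro homotopic_paths_join homotopic_paths_sym[OF 4]) (auto simp: path_between_def path_image_join)
  have "\<Theta> p \<otimes>\<^bsub>fundamental_group S x\<^esub> \<Theta> q
      = loop_class S (((\<tau> y +++ p) +++ reversepath (\<tau> z)) +++ ((\<tau> z +++ q) +++ reversepath (\<tau> w)))"
    using \<Theta>_loop[OF p] \<Theta>_loop[OF q] p q
    by (simp add: \<Theta>_def path_between_def fundamental_group_mult)
  also have "\<dots> = loop_class S ((\<tau> y +++ (p +++ q)) +++ reversepath (\<tau> w))"
    by (rule loop_class_cong[OF homotopic_paths_trans[OF 5 homotopic_paths_trans[OF 1 homotopic_paths_trans[OF 2 3]]]])
  also have "\<dots> = \<Theta> (p +++ q)"
    using p q by (simp add: \<Theta>_def path_between_def)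
  finally show ?thesis ..
qed

text \<open>A constant path is idempotent up to homotopy, and the only idempotent of a group is its
  unit.\<close>

lemma \<Theta>_const:
  assumes "y \<in> S"
  shows "\<Theta> (\<lambda>_. y) = \<one>\<^bsub>fundamental_group S x\<^esub>"
proof -
  have c: "path_between S y y (\<lambda>_. y)"
    using assms by (rule path_between_const)
  have "\<Theta> (\<lambda>_. y) \<otimes>\<^bsub>fundamental_group S x\<^esub> \<Theta> (\<lambda>_. y) = \<Theta> (\<lambda>_. y)"
    using \<Theta>_join[OF c c] \<Theta>_cong[OF homotopic_paths_left_const[OF c]] by simp
  then show ?thesis
    using \<Theta>_carrier[OF c] pi1.r_cancel_one' by metis
qed

text \<open>The source of all relations between path classes: \<open>C\<close> will be an interval
  (cutting a path), a plane triangle (a face) or a square (coning off).\<close>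

lemma \<Theta>_triangle:
  fixes C :: "'c::real_normed_vector set"
  assumes "convex C" "a \<in> C" "b \<in> C" "c \<in> C" "continuous_on C h" "h \<in> C \<rightarrow> S"
  shows "\<Theta> (h \<circ> linepath a b) \<otimes>\<^bsub>fundamental_group S x\<^esub> \<Theta> (h \<circ> linepath b c) = \<Theta> (h \<circ> linepath a c)"
proof -
  have "path_between S (h u) (h v) (h \<circ> linepath u v)" if "u \<in> C" "v \<in> C" for u v
    unfolding path_between_def
  proof (intro conjI)
    have sub: "closed_segment u v \<subseteq> C"
      using that assms(1) by (simp add: closed_segment_subset)
    show "path (h \<circ> linepath u v)"
      using assms(5) sub by (intro path_continuous_image) (auto intro: continuous_on_subset)
    show "path_image (h \<circ> linepath u v) \<subseteq> S"
      using assms(6) sub by (auto simp: path_image_compose)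
  qed (auto simp: pathstart_compose pathfinish_compose)
  from \<Theta>_join[OF this this] show ?thesis
    using \<Theta>_cong[OF homotopic_paths_image_triangle[OF assms]] assms(2-4) by simp
qed

text \<open>The loop \<open>\<tau> x\<close> is not assumed to be constant, so on loops \<Theta> is
  conjugation rather than the identity. A conjugate is trivial only if the element is, which is all
  that is used.\<close>

lemma \<Theta>_loop_class:
  assumes "p \<in> loops_at S x"
  shows "\<Theta> p = loop_class S (\<tau> x) \<otimes>\<^bsub>fundamental_group S x\<^esub> loop_class S p
           \<otimes>\<^bsub>fundamental_group S x\<^esub> loop_class S (reversepath (\<tau> x))"
  using assms connect[OF x]
  by (simp add: \<Theta>_def fundamental_group_mult loops_at_path_between path_between_join path_between_reversepath)
     (simp add: path_between_def)

lemma loop_class_eq_one_if_\<Theta>: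
  assumes "p \<in> loops_at S x" "\<Theta> p = \<one>\<^bsub>fundamental_group S x\<^esub>"
  shows "loop_class S p = \<one>\<^bsub>fundamental_group S x\<^esub>"
proof -
  let ?t = "loop_class S (\<tau> x)" and ?t' = "loop_class S (reversepath (\<tau> x))"
  have c: "?t \<in> carrier (fundamental_group S x)" "?t' \<in> carrier (fundamental_group S x)"
      "loop_class S p \<in> carrier (fundamental_group S x)"
    using connect[OF x] assms(1) by (auto simp: fundamental_group_def loops_at_path_between path_between_reversepath)
  have "?t \<otimes>\<^bsub>fundamental_group S x\<^esub> ?t' = \<one>\<^bsub>fundamental_group S x\<^esub>"
    using connect[OF x] homotopic_paths_join_reversepath[OF connect[OF x]]
    by (simp add: fundamental_group_mult loops_at_path_between path_between_reversepath)
       (simp add: fundamental_group_def loop_class_cong)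
  then have "?t' = inv\<^bsub>fundamental_group S x\<^esub> ?t"
    using c by (metis pi1.inv_equality pi1.inv_inv)
  then have "?t \<otimes>\<^bsub>fundamental_group S x\<^esub> loop_class S p = ?t"
    using assms(2) \<Theta>_loop_class[OF assms(1)] c by (simp add: pi1.inv_solve_right[symmetric] pi1.inv_solve_right')
  then show ?thesis
    using c by (simp add: pi1.r_cancel_one)
qed

end

section \<open>Segments and stars in the realization\<close>

locale simplicial_complex =
  fixes V :: "'a set" and H :: "'a set set"
  assumes complex: "abstract_complex V H"
begin

abbreviation S :: "('a \<Rightarrow> real) set" where
  "S \<equiv> geometric_realization V H"

text \<open>Thus \<open>v \<in> support y\<close> says that \<open>y\<close> lies in the open star
  of \<open>v\<close>; on the realization positive and nonzero coordinates are the same.\<close>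

definition support :: "('a \<Rightarrow> real) \<Rightarrow> 'a set" where
  "support y = {v. 0 < y v}"

definition vertex_point :: "'a \<Rightarrow> 'a \<Rightarrow> real" where
  "vertex_point v = (\<lambda>w. if w = v then 1 else 0)"

text \<open>Written coordinatewise, because points are functions with the product topology and not
  elements of a normed space.\<close>

definition segment :: "('a \<Rightarrow> real) \<Rightarrow> ('a \<Rightarrow> real) \<Rightarrow> real \<Rightarrow> 'a \<Rightarrow> real" where
  "segment y z = (\<lambda>t v. (1 - t) * y v + t * z v)"

lemma finite_V: "finite V" and face_subset: "I \<in> H \<Longrightarrow> I \<subseteq> V"
  and face_mono: "I \<in> H \<Longrightarrow> J \<subseteq> I \<Longrightarrow> J \<in> H" and vertex_face: "v \<in> V \<Longrightarrow> {v} \<in> H"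
  using complex by (auto simp: abstract_complex_def)

lemma realization_iff:
  "y \<in> S \<longleftrightarrow> (\<forall>v. 0 \<le> y v) \<and> support y \<in> H \<and> (\<Sum>v\<in>V. y v) = 1"
proof -
  have "{v. y v \<noteq> 0} = support y" if "\<forall>v. 0 \<le> y v"
    using that by (auto simp: support_def less_le)
  then show ?thesis
    by (auto simp: geometric_realization_def)
qed

lemma support_nonempty:
  assumes "y \<in> S" obtains v where "v \<in> V" "v \<in> support y"
proof -
  have "\<exists>v\<in>V. y v \<noteq> 0"
    using assms sum.neutral[of V y] by (fastforce simp: realization_iff)
  then show ?thesis
    using assms that by (auto simp: realization_iff support_def less_le)
qed

lemma support_face: "y \<in> S \<Longrightarrow> J \<subseteq> support y \<Longrightarrow> J \<in> H"
  by (auto simp: realization_iff intro: face_mono)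

lemma support_vertex_point [simp]: "support (vertex_point v) = {v}"
  by (auto simp: support_def vertex_point_def)

lemma vertex_point_in: "v \<in> V \<Longrightarrow> vertex_point v \<in> S"
  using finite_V by (auto simp: realization_iff vertex_face) (auto simp: vertex_point_def)

text \<open>Three points serve both for triangles and for segments, where one point is repeated with
  weight 0.\<close>

lemma convex_combination_in:
  assumes "y \<in> S" "z \<in> S" "w \<in> S" "support y \<union> support z \<union> support w \<in> H"
    and "0 \<le> a" "0 \<le> b" "0 \<le> c" "a + b + c = 1"
  shows "(\<lambda>v. a * y v + b * z v + c * w v) \<in> S"
  unfolding realization_iff
proof (intro conjI allI)
  have nonneg: "0 \<le> y v" "0 \<le> z v" "0 \<le> w v" for v
    using assms(1-3) by (auto simp: realization_iff)
  show "0 \<le> a * y v + b * z v + c * w v" for v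
    using nonneg assms(5-7) by simp
  have "support (\<lambda>v. a * y v + b * z v + c * w v) \<subseteq> support y \<union> support z \<union> support w"
  proof
    fix v assume "v \<in> support (\<lambda>v. a * y v + b * z v + c * w v)"
    then have "\<not> (y v = 0 \<and> z v = 0 \<and> w v = 0)"
      by (auto simp: support_def)
    then show "v \<in> support y \<union> support z \<union> support w"
      using nonneg[of v] by (auto simp: support_def)
  qed
  then show "support (\<lambda>v. a * y v + b * z v + c * w v) \<in> H"
    using assms(4) face_mono by blast
  show "(\<Sum>v\<in>V. a * y v + b * z v + c * w v) = 1"
    using assms by (simp add: sum.distrib sum_distrib_left[symmetric] realization_iff)
qed

text \<open>The affine map that sends the plane points \<open>(0, 0)\<close>, \<open>(1, 0)\<close>,
  \<open>(0, 1)\<close> to \<open>y\<close>, \<open>z\<close>, \<open>w\<close>. It moves homotopies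
  between sides of a face into a convex subset of the plane.\<close>

definition barycentric :: "('a \<Rightarrow> real) \<Rightarrow> ('a \<Rightarrow> real) \<Rightarrow> ('a \<Rightarrow> real) \<Rightarrow> real \<times> real \<Rightarrow> 'a \<Rightarrow> real" where
  "barycentric y z w = (\<lambda>r v. (1 - fst r - snd r) * y v + fst r * z v + snd r * w v)"

lemma segment_barycentric:
  "segment y z = barycentric y z w \<circ> linepath (0, 0) (1, 0)"
  "segment z w = barycentric y z w \<circ> linepath (1, 0) (0, 1)"
  "segment y w = barycentric y z w \<circ> linepath (0, 0) (0, 1)"
  by (auto simp: fun_eq_iff segment_def barycentric_def linepath_def)

definition "unit_triangle = {r :: real \<times> real. 0 \<le> fst r \<and> 0 \<le> snd r \<and> fst r + snd r \<le> 1}"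

lemma unit_triangle:
  "convex unit_triangle" "(0, 0) \<in> unit_triangle" "(1, 0) \<in> unit_triangle" "(0, 1) \<in> unit_triangle"
proof -
  have "u * a + v * c + (u * b + v * d) \<le> 1"
    if "a + b \<le> 1" "c + d \<le> 1" "0 \<le> u" "0 \<le> v" "u + v = 1" for a b c d u v :: real
  proof -
    have "u * (a + b) + v * (c + d) \<le> u * 1 + v * 1"
      using that by (intro add_mono mult_left_mono) auto
    then show ?thesis using that by (simp add: algebra_simps)
  qed
  then show "convex unit_triangle"
    by (auto simp: convex_def unit_triangle_def)
qed (auto simp: unit_triangle_def)

lemma barycentric_in:
  assumes "y \<in> S" "z \<in> S" "w \<in> S" "support y \<union> support z \<union> support w \<in> H"
  shows "barycentric y z w \<in> unit_triangle \<rightarrow> S"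
  using assms convex_combination_in[OF assms] by (auto simp: barycentric_def unit_triangle_def)

lemma continuous_barycentric: "continuous_on A (barycentric y z w)"
  unfolding barycentric_def by (intro continuous_intros)

lemma path_between_segment:
  assumes "y \<in> S" "z \<in> S" "support y \<union> support z \<in> H"
  shows "path_between S y z (segment y z)"
  unfolding path_between_def
proof (intro conjI)
  show "path (segment y z)"
    unfolding path_def segment_def by (intro continuous_intros)
  show "path_image (segment y z) \<subseteq> S"
    using convex_combination_in[of y z z "1 - t" t 0 for t] assms
    by (auto simp: path_image_def segment_def)
qed (auto simp: pathstart_def pathfinish_def segment_def)

lemma path_between_edge:
  assumes "{u, v} \<in> H"
  shows "path_between S (vertex_point u) (vertex_point v) (segment (vertex_point u) (vertex_point v))"
  using assms face_subset[OF assms] by (intro path_between_segment) (auto simp: vertex_point_in insert_commute)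

end

section \<open>Paths inside a face or a star\<close>

locale based_complex = simplicial_complex V H + based_space "geometric_realization V H" x \<tau>
  for V :: "'a set" and H x \<tau>
begin

abbreviation G :: "(real \<Rightarrow> 'a \<Rightarrow> real) set monoid" where
  "G \<equiv> fundamental_group S x"

lemma \<Theta>_segment_triangle:
  assumes "y \<in> S" "z \<in> S" "w \<in> S" "support y \<union> support z \<union> support w \<in> H"
  shows "\<Theta> (segment y z) \<otimes>\<^bsub>G\<^esub> \<Theta> (segment z w) = \<Theta> (segment y w)"
  using \<Theta>_triangle[OF unit_triangle(1,2,3,4) continuous_barycentric barycentric_in[OF assms]]
  by (simp only: segment_barycentric[symmetric])

text \<open>Coning off to \<open>v\<close> maps the unit square to the realization; the given path is its bottom side
  and the other three sides form the path through \<open>v\<close>.\<close>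

lemma \<Theta>_in_star:
  assumes p: "path_between S y z p" and star: "\<And>t. t \<in> {0..1} \<Longrightarrow> v \<in> support (p t)"
  shows "\<Theta> p = \<Theta> (segment y (vertex_point v)) \<otimes>\<^bsub>G\<^esub> \<Theta> (segment (vertex_point v) z)"
proof -
  define h where "h = (\<lambda>r::real \<times> real. \<lambda>w. (1 - snd r) * p (fst r) w + snd r * vertex_point v w)"
  define Q where "Q = {0..1::real} \<times> {0..1::real}"
  have pS: "p t \<in> S" if "t \<in> {0..1}" for t
    using p that by (auto simp: path_between_def path_image_def)
  have vV: "v \<in> V"
    using pS[of 0] star[of 0] face_subset by (auto simp: realization_iff)
  have conv: "convex Q" unfolding Q_def by (intro convex_Times convex_real_interval)
  have "continuous_on Q (\<lambda>r. p (fst r))"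
    by (rule continuous_on_compose2[of "{0..1}" p])
       (use p in \<open>auto simp: path_between_def path_def Q_def intro!: continuous_intros\<close>)
  then have "continuous_on Q (\<lambda>r. p (fst r) w)" for w
    by (rule continuous_on_product_then_coordinatewise)
  then have cont: "continuous_on Q h"
    unfolding h_def by (intro continuous_intros)
  have img: "h \<in> Q \<rightarrow> S"
  proof
    fix r assume "r \<in> Q"
    then have r: "fst r \<in> {0..1}" "snd r \<in> {0..1}" by (auto simp: Q_def)
    \<comment> \<open>Since \<open>v\<close> already belongs to the support, moving towards
      \<open>v\<close> does not leave the face that carries the point.\<close>
    have "support (p (fst r)) \<union> support (vertex_point v) \<union> support (vertex_point v) = support (p (fst r))"
      using star[OF r(1)] by auto
    then show "h r \<in> S"
      using convex_combination_in[of "p (fst r)" "vertex_point v" "vertex_point v" "1 - snd r" "snd r" 0]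
        r pS[OF r(1)] vertex_point_in[OF vV]
      by (simp add: h_def realization_iff)
  qed
  note tri = \<Theta>_triangle[OF conv _ _ _ cont img]
  have ends: "p 0 = y" "p 1 = z"
    using p by (auto simp: path_between_def pathstart_def pathfinish_def)
  have sides: "h \<circ> linepath (0, 0) (1, 0) = p" "h \<circ> linepath (0, 0) (0, 1) = segment y (vertex_point v)"
    "h \<circ> linepath (0, 1) (1, 1) = (\<lambda>_. vertex_point v)" "h \<circ> linepath (1, 1) (1, 0) = segment (vertex_point v) z"
    using ends by (auto simp: fun_eq_iff h_def linepath_def segment_def)
  have Q: "(0, 0) \<in> Q" "(0, 1) \<in> Q" "(1, 0) \<in> Q" "(1, 1) \<in> Q" by (auto simp: Q_def)
  \<comment> \<open>The diagonal from \<open>(0, 1)\<close> to \<open>(1, 0)\<close> cuts the square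
    into two triangles; the top side is constant and drops out.\<close>
  have "\<Theta> (h \<circ> linepath (0, 1) (1, 1)) \<otimes>\<^bsub>G\<^esub> \<Theta> (h \<circ> linepath (1, 1) (1, 0)) = \<Theta> (h \<circ> linepath (0, 1) (1, 0))"
    using Q by (intro tri)
  moreover have "\<Theta> (h \<circ> linepath (0, 0) (0, 1)) \<otimes>\<^bsub>G\<^esub> \<Theta> (h \<circ> linepath (0, 1) (1, 0)) = \<Theta> (h \<circ> linepath (0, 0) (1, 0))"
    using Q by (intro tri)
  moreover have "path_between S (vertex_point v) z (segment (vertex_point v) z)"
    using star[of 1] pS[of 1] vertex_point_in[OF vV] support_face[of z "support z"] ends
    by (intro path_between_segment) (auto simp: insert_absorb)
  ultimately show ?thesis
    by (simp add: sides \<Theta>_const vertex_point_in vV \<Theta>_carrier)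
qed

end

section \<open>Holonomy of cocycles\<close>

context simplicial_complex
begin

text \<open>The path maps the interval from \<open>i / n\<close> to \<open>(i + 1) / n\<close> into the open star of \<open>l i\<close>.\<close>

definition adapted :: "(real \<Rightarrow> 'a \<Rightarrow> real) \<Rightarrow> nat \<Rightarrow> (nat \<Rightarrow> 'a) \<Rightarrow> bool" where
  "adapted p n l \<longleftrightarrow> 0 < n \<and> (\<forall>i<n. \<forall>t. real i \<le> t * n \<and> t * n \<le> real i + 1 \<longrightarrow> l i \<in> support (p t))"

lemma adaptedD:
  assumes "adapted p n l" "i < n"
  shows "l i \<in> support (p (i / n))" "l i \<in> support (p (Suc i / n))"
  using assms by (auto simp: adapted_def)

lemma adapted_refine:
  assumes "adapted p n l" "0 < m"
  shows "adapted p (n * m) (\<lambda>i. l (i div m))"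
  unfolding adapted_def
proof (intro conjI allI impI)
  fix i t assume i: "i < n * m" and t: "real i \<le> t * real (n * m) \<and> t * real (n * m) \<le> real i + 1"
  have "i div m < n"
    using i by (simp add: less_mult_imp_div_less)
  moreover have "real (i div m) * m \<le> real i" "real i + 1 \<le> (real (i div m) + 1) * m"
  proof -
    have "i div m * m \<le> i" by simp
    then show "real (i div m) * m \<le> real i" by (metis of_nat_le_iff of_nat_mult)
    have "i + 1 \<le> (i div m + 1) * m"
      using dividend_less_div_times[OF assms(2), of i] by (simp add: algebra_simps)
    then show "real i + 1 \<le> (real (i div m) + 1) * m"
      by (metis of_nat_1 of_nat_add of_nat_le_iff of_nat_mult)
  qed
  then have "real (i div m) * m \<le> t * n * m" "t * n * m \<le> (real (i div m) + 1) * m"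
    using t by (simp_all add: mult.assoc)
  then have "real (i div m) \<le> t * n" "t * n \<le> real (i div m) + 1"
    using assms(2) by simp_all
  ultimately show "l (i div m) \<in> support (p t)"
    using assms(1) by (auto simp: adapted_def)
qed (use assms in \<open>auto simp: adapted_def\<close>)

text \<open>The join gives half of the time to each path, so an equal division of the whole requires
  the same number of intervals in both; refinement provides it.\<close>

lemma adapted_join:
  assumes p: "adapted p n l" and q: "adapted q n l'" and pq: "p 1 = q 0"
  shows "adapted (p +++ q) (2 * n) (\<lambda>i. if i < n then l i else l' (i - n))"
  unfolding adapted_def
proof (intro conjI allI impI)
  have n: "0 < n" using p by (simp add: adapted_def)
  then show "0 < 2 * n" by simp
  fix i t assume i: "i < 2 * n" and t: "real i \<le> t * real (2 * n) \<and> t * real (2 * n) \<le> real i + 1"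
  show "(if i < n then l i else l' (i - n)) \<in> support ((p +++ q) t)"
  proof (cases "i < n")
    case True
    have "t * 2 * n \<le> real i + 1" using t by (simp add: mult.assoc)
    also have "\<dots> \<le> 1 * real n" using True by simp
    finally have "t * 2 * n \<le> 1 * real n" .
    then have "t * 2 \<le> 1" by (rule mult_right_le_imp_le) (simp add: n)
    then show ?thesis
      using p t True by (auto simp: adapted_def joinpaths_def)
  next
    case False
    then have "1 * real n \<le> t * 2 * n" using t by simp
    then have t1: "1 \<le> t * 2" by (rule mult_right_le_imp_le) (simp add: n)
    \<comment> \<open>At \<open>t = 1/2\<close> the join still evaluates \<open>p\<close>; this is
      where \<open>p 1 = q 0\<close> enters.\<close>
    have "(p +++ q) t = q (2 * t - 1)"
      using t1 pq by (cases "t * 2 = 1") (auto simp: joinpaths_def field_simps)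
    moreover have "l' (i - n) \<in> support (q (2 * t - 1))"
      using q t False i by (auto simp: adapted_def algebra_simps of_nat_diff)
    ultimately show ?thesis using False by simp
  qed
qed

text \<open>Lebesgue number of the cover of the square by the preimages of open stars. One labelling
  \<open>l j\<close> serves all \<open>s\<close> in the closed interval number \<open>j\<close>,
  hence both of its ends: this links neighbouring stages of a homotopy.\<close>

lemma adapted_grid:
  fixes h :: "real \<times> real \<Rightarrow> 'a \<Rightarrow> real"
  assumes cont: "continuous_on ({0..1} \<times> {0..1}) h" and img: "h \<in> {0..1} \<times> {0..1} \<rightarrow> S"
  obtains n l where "0 < n"
    "\<And>j s. j < n \<Longrightarrow> real j \<le> s * n \<Longrightarrow> s * n \<le> real j + 1 \<Longrightarrow> adapted (\<lambda>t. h (s, t)) n (l j)"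
proof -
  define Q where "Q = {0..1::real} \<times> {0..1::real}"
  have "\<exists>B. open B \<and> B \<inter> Q = (\<lambda>r. h r v) -` {0<..} \<inter> Q" for v
    using continuous_on_product_then_coordinatewise[OF cont, of v]
    unfolding continuous_on_open_invariant Q_def[symmetric] by (metis open_greaterThan)
  then obtain B where B: "\<And>v. open (B v)" "\<And>v. B v \<inter> Q = (\<lambda>r. h r v) -` {0<..} \<inter> Q"
    by metis
  have "compact Q" unfolding Q_def by (intro compact_Times) auto
  moreover have "Q \<subseteq> \<Union>(range B)"
  proof
    fix r assume "r \<in> Q"
    then have "h r \<in> S" using img by (auto simp: Q_def)
    then obtain v where "v \<in> support (h r)" by (rule support_nonempty)
    then have "r \<in> B v \<inter> Q"
      using \<open>r \<in> Q\<close> by (simp add: B(2) support_def)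
    then show "r \<in> \<Union>(range B)" by auto
  qed
  ultimately obtain \<delta> where \<delta>: "0 < \<delta>" "\<And>T. T \<subseteq> Q \<Longrightarrow> diameter T < \<delta> \<Longrightarrow> \<exists>U\<in>range B. T \<subseteq> U"
    using Lebesgue_number_lemma[of Q "range B"] B(1) by (metis UNIV_not_empty image_is_empty rangeE)
  \<comment> \<open>A square of side \<open>1 / n\<close> has diameter at most \<open>2 / n\<close>,
    the sum of its two sides.\<close>
  obtain n :: nat where n: "0 < n" "2 / \<delta> < n"
    using reals_Archimedean2[of "2 / \<delta>"] \<delta>(1)
    by (metis divide_pos_pos less_trans of_nat_0_less_iff zero_less_numeral)
  define I where "I = (\<lambda>i::nat. {t::real. real i \<le> t * n \<and> t * n \<le> real i + 1})"
  have I: "I i \<subseteq> {0..1}" if "i < n" for i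
  proof
    fix t assume "t \<in> I i"
    then have "t * n \<le> real i + 1" "0 * real n \<le> t * n" by (auto simp: I_def)
    moreover have "real i + 1 \<le> 1 * real n" using that by simp
    ultimately have t: "0 * real n \<le> t * n" "t * n \<le> 1 * real n" by (blast intro: order_trans)+
    show "t \<in> {0..1}"
      using mult_right_le_imp_le[OF t(1)] mult_right_le_imp_le[OF t(2)] n(1) by simp
  qed
  have "\<exists>v. \<forall>s\<in>I j. \<forall>t\<in>I i. v \<in> support (h (s, t))" if "j < n" "i < n" for j i
  proof -
    have "I j \<times> I i \<subseteq> Q"
      using I that by (auto simp: Q_def)
    moreover have "diameter (I j \<times> I i) \<le> 2 / n"
    proof (rule diameter_le)
      show "I j \<times> I i \<noteq> {} \<or> 0 \<le> 2 / real n" by simp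
      have *: "\<bar>a - b\<bar> \<le> 1 / n" if "a \<in> I k" "b \<in> I k" for a b k
      proof -
        have "\<bar>a - b\<bar> * n = \<bar>a * n - b * n\<bar>" by (simp add: abs_mult flip: left_diff_distrib)
        also have "\<dots> \<le> 1" using that by (auto simp: I_def)
        finally show ?thesis using n(1) by (simp add: field_simps)
      qed
      fix r r' assume "r \<in> I j \<times> I i" "r' \<in> I j \<times> I i"
      then have "\<bar>fst r - fst r'\<bar> \<le> 1 / n" "\<bar>snd r - snd r'\<bar> \<le> 1 / n"
        using * by auto
      moreover have "norm (r - r') \<le> \<bar>fst r - fst r'\<bar> + \<bar>snd r - snd r'\<bar>"
        using norm_Pair_le[of "fst (r - r')" "snd (r - r')"] unfolding prod.collapse by simp
      ultimately show "norm (r - r') \<le> 2 / real n" by simp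
    qed
    moreover have "2 / real n < \<delta>"
      using n \<delta>(1) by (simp add: field_simps)
    ultimately obtain v where "I j \<times> I i \<subseteq> B v"
      using \<delta>(2)[of "I j \<times> I i"] by auto
    then have "I j \<times> I i \<subseteq> (\<lambda>r. h r v) -` {0<..} \<inter> Q"
      using \<open>I j \<times> I i \<subseteq> Q\<close> B(2)[of v] by blast
    then show ?thesis
      by (intro exI[of _ v]) (auto simp: support_def)
  qed
  then obtain l where "\<And>j i s t. j < n \<Longrightarrow> i < n \<Longrightarrow> s \<in> I j \<Longrightarrow> t \<in> I i \<Longrightarrow> l j i \<in> support (h (s, t))"
    by metis
  then show ?thesis
    using n(1) by (intro that[of n l]) (auto simp: adapted_def I_def)
qed

end

section \<open>Transport along subdivided paths\<close>

locale cocycle = simplicial_complex V H + group F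
  for V :: "'a set" and H and F (structure) +
  fixes c :: "'a \<Rightarrow> 'a \<Rightarrow> 'f"
  assumes c_closed: "{u, v} \<in> H \<Longrightarrow> c u v \<in> carrier F"
    and c_triangle: "{u, v, w} \<in> H \<Longrightarrow> c u v \<otimes> c v w = c u w"
begin

text \<open>The triangle law also covers faces written with repeated vertices:
  \<open>v, v, v\<close> makes \<open>c v v\<close> idempotent, and \<open>v, u, v\<close> yields
  the inverse law that follows.\<close>

lemma c_refl: "v \<in> V \<Longrightarrow> c v v = \<one>"
  using c_triangle[of v v v] c_closed[of v v] vertex_face[of v] by (simp add: l_cancel_one)

lemma c_sym: "{u, v} \<in> H \<Longrightarrow> c v u = inv (c u v)"
  using c_triangle[of v u v] c_closed[of u v] c_closed[of v u] c_refl[of v] face_subset[of "{u, v}"]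
  by (simp add: insert_commute inv_equality)

text \<open>The value at time \<open>i / n\<close> seen from an arbitrary vertex \<open>w\<close> whose star contains the
  point, so that no vertex has to be singled out at the subdivision points.\<close>

fun transport :: "'a \<Rightarrow> (nat \<Rightarrow> 'a) \<Rightarrow> nat \<Rightarrow> 'a \<Rightarrow> 'f" where
  "transport u l 0 w = c u w"
| "transport u l (Suc i) w = transport u l i (l i) \<otimes> c (l i) w"

text \<open>The vertices whose stars contain a given point form a face, so the triangle law relates
  the values seen from any two of them. Membership in the carrier belongs to the same induction
  because reassociating needs it.\<close>

lemma transport_change:
  assumes p: "\<And>t. t \<in> {0..1} \<Longrightarrow> p t \<in> S" "u \<in> support (p 0)" "adapted p n l"
  shows "i \<le> n \<Longrightarrow> w \<in> support (p (i / n)) \<Longrightarrow> w' \<in> support (p (i / n)) \<Longrightarrow>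
    transport u l i w \<in> carrier F \<and> transport u l i w \<otimes> c w w' = transport u l i w'"
proof (induction i arbitrary: w w')
  case 0
  then have "{u, w} \<in> H" "{u, w, w'} \<in> H"
    using support_face[OF p(1)[of 0]] p(2) by auto
  then show ?case
    by (simp add: c_closed c_triangle)
next
  case (Suc i)
  have n: "i < n" "real (Suc i) / n \<in> {0..1}" using Suc.prems by auto
  note l = adaptedD[OF p(3) n(1)]
  have "{l i, w} \<in> H" "{w, w'} \<in> H" "{l i, w, w'} \<in> H"
    using support_face[OF p(1)[OF n(2)]] l(2) Suc.prems by auto
  moreover have "transport u l i (l i) \<in> carrier F"
    using Suc.IH[of "l i" "l i"] n l(1) by simp
  ultimately show ?case
    by (simp add: c_closed c_triangle m_assoc)
qed

text \<open>At a subdivision point both labels lie in one face. One labelling is exchanged for the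
  other before the step, and the triangle law at the end of the step absorbs the exchange.\<close>

lemma transport_unique:
  assumes p: "\<And>t. t \<in> {0..1} \<Longrightarrow> p t \<in> S" "u \<in> support (p 0)" and l: "adapted p n l" and l': "adapted p n l'"
  shows "i \<le> n \<Longrightarrow> w \<in> support (p (i / n)) \<Longrightarrow> transport u l i w = transport u l' i w"
proof (induction i arbitrary: w)
  case (Suc i)
  have n: "i < n" "real (Suc i) / n \<in> {0..1}" using Suc.prems by auto
  note a = adaptedD[OF l n(1)] and a' = adaptedD[OF l' n(1)]
  note ch = transport_change[OF p l] transport_change[OF p l']
  have H: "{l i, w} \<in> H" "{l' i, l i} \<in> H" "{l' i, l i, w} \<in> H"
    using support_face[OF p(1)[OF n(2)]] a a' Suc.prems by auto
  have "transport u l i (l i) = transport u l i (l' i) \<otimes> c (l' i) (l i)"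
    using ch(1)[of i "l' i" "l i"] n(1) a a' by simp
  also have "transport u l i (l' i) = transport u l' i (l' i)"
    using Suc.IH n(1) a' by simp
  finally show ?case
    using H ch(2)[of i "l' i" "l' i"] n(1) a' by (simp add: m_assoc c_closed c_triangle)
qed simp

text \<open>Inside a coarse interval the label does not change, so the extra steps multiply by
  \<open>c v v = \<one>\<close>; only the last of the \<open>m\<close> fine steps moves on to
  \<open>w\<close>.\<close>

lemma transport_refine:
  assumes p: "\<And>t. t \<in> {0..1} \<Longrightarrow> p t \<in> S" "u \<in> support (p 0)" and l: "adapted p n l" and m: "0 < m"
  shows "i \<le> n \<Longrightarrow> w \<in> support (p (i / n)) \<Longrightarrow>
    transport u (\<lambda>i. l (i div m)) (i * m) w = transport u l i w"
proof (induction i arbitrary: w)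
  case (Suc i)
  let ?l = "\<lambda>i. l (i div m)"
  have n: "i < n" "real (Suc i) / n \<in> {0..1}" using Suc.prems by auto
  note a = adaptedD[OF l n(1)]
  have step: "transport u ?l (i * m + j) (l i) = transport u l i (l i)" if "j < m" for j
    using that
  proof (induction j)
    case 0
    then show ?case using Suc.IH n(1) a by simp
  next
    case (Suc j)
    have "l i \<in> V" using a(2) p(1)[OF n(2)] face_subset by (auto simp: realization_iff)
    moreover have "transport u l i (l i) \<in> carrier F"
      using transport_change[OF p l] n(1) a by auto
    moreover have "(i * m + j) div m = i" using Suc.prems by simp
    ultimately show ?case
      using Suc by (simp add: c_refl)
  qed
  obtain k where k: "m = Suc k" using m by (cases m) auto
  have "Suc i * m = Suc (i * m + k)" "k < m"
    using k m by auto
  moreover have "(i * m + k) div m = i"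
    using \<open>k < m\<close> by simp
  ultimately show ?case
    using step[of k] by (simp only: transport.simps)
qed simp

text \<open>A relation, since existence (a Lebesgue number) and uniqueness (a common refinement) are
  separate facts. The end vertices are chosen in the supports of the end points, which need not be
  vertices themselves.\<close>

definition holonomy :: "(real \<Rightarrow> 'a \<Rightarrow> real) \<Rightarrow> 'a \<Rightarrow> 'a \<Rightarrow> 'f \<Rightarrow> bool" where
  "holonomy p u v g \<longleftrightarrow> u \<in> support (p 0) \<and> v \<in> support (p 1) \<and> (\<exists>n l. adapted p n l \<and> g = transport u l n v)"

lemma holonomy_unique:
  assumes p: "\<And>t. t \<in> {0..1} \<Longrightarrow> p t \<in> S" and g: "holonomy p u v g" and g': "holonomy p u v g'"
  shows "g = g'"
proof -
  obtain n l n' l' where l: "adapted p n l" "g = transport u l n v" and l': "adapted p n' l'" "g' = transport u l' n' v"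
    using g g' by (auto simp: holonomy_def)
  have u: "u \<in> support (p 0)" and v: "v \<in> support (p 1)"
    using g by (auto simp: holonomy_def)
  have pos: "0 < n" "0 < n'" using l l' by (auto simp: adapted_def)
  have "g = transport u (\<lambda>i. l (i div n')) (n * n') v"
    using transport_refine[OF p u l(1) pos(2), of n v] v pos l(2) by simp
  also have "\<dots> = transport u (\<lambda>i. l' (i div n)) (n * n') v"
    using transport_unique[OF p u adapted_refine[OF l(1) pos(2)] adapted_refine[OF l'(1) pos(1), unfolded mult.commute[of n']], of "n * n'" v]
      v pos by simp
  also have "\<dots> = g'"
    using transport_refine[OF p u l'(1) pos(1), of n' v] v pos l'(2) by (simp add: mult.commute)
  finally show ?thesis .
qed

lemma holonomy_closed:
  assumes "\<And>t. t \<in> {0..1} \<Longrightarrow> p t \<in> S" "holonomy p u v g"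
  shows "g \<in> carrier F"
proof -
  obtain n l where l: "adapted p n l" "g = transport u l n v" and u: "u \<in> support (p 0)" and v: "v \<in> support (p 1)"
    using assms(2) by (auto simp: holonomy_def)
  then show ?thesis
    using transport_change[OF assms(1) u l(1), of n v v] by (auto simp: adapted_def)
qed

lemma holonomy_exists:
  assumes "path p" "path_image p \<subseteq> S" "u \<in> support (p 0)" "v \<in> support (p 1)"
  obtains n l where "adapted p n l" "holonomy p u v (transport u l n v)"
proof -
  \<comment> \<open>The grid for the constant homotopy at \<open>p\<close> contains a subdivision of
    \<open>p\<close>.\<close>
  have "continuous_on ({0..1} \<times> {0..1}) (\<lambda>r::real \<times> real. p (snd r))"
    by (rule continuous_on_compose2[of "{0..1}" p]) (use assms in \<open>auto simp: path_def intro!: continuous_intros\<close>)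
  moreover have "(\<lambda>r::real \<times> real. p (snd r)) \<in> {0..1} \<times> {0..1} \<rightarrow> S"
    using assms by (auto simp: path_image_def)
  ultimately obtain n l where n: "0 < n" "\<And>j s. j < n \<Longrightarrow> real j \<le> s * n \<Longrightarrow> s * n \<le> real j + 1 \<Longrightarrow> adapted p n (l j)"
    using adapted_grid[of "\<lambda>r. p (snd r)"] by auto
  have "adapted p n (l 0)"
    using n(2)[of 0 0] n(1) by simp
  then show ?thesis
    using assms by (intro that[of n "l 0"]) (auto simp: holonomy_def)
qed

lemma holonomy_join:
  assumes p: "\<And>t. t \<in> {0..1} \<Longrightarrow> p t \<in> S" "holonomy p u v g"
    and q: "\<And>t. t \<in> {0..1} \<Longrightarrow> q t \<in> S" "holonomy q v w g'" and pq: "p 1 = q 0"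
  shows "holonomy (p +++ q) u w (g \<otimes> g')"
proof -
  obtain n0 l0 n1 l1 where l0: "adapted p n0 l0" "g = transport u l0 n0 v"
    and l1: "adapted q n1 l1" "g' = transport v l1 n1 w"
    using p q by (auto simp: holonomy_def)
  have u: "u \<in> support (p 0)" and v: "v \<in> support (p 1)" "v \<in> support (q 0)" and w: "w \<in> support (q 1)"
    using p(2) q(2) by (auto simp: holonomy_def)
  have pos: "0 < n0" "0 < n1" using l0 l1 by (auto simp: adapted_def)
  define n where "n = n0 * n1"
  define l where "l = (\<lambda>i. l0 (i div n1))"
  define l' where "l' = (\<lambda>i. l1 (i div n0))"
  define L where "L = (\<lambda>i. if i < n then l i else l' (i - n))"
  have n: "0 < n" using pos by (simp add: n_def)
  have al: "adapted p n l"
    using adapted_refine[OF l0(1) pos(2)] by (simp add: n_def l_def)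
  have al': "adapted q n l'"
    using adapted_refine[OF l1(1) pos(1)] by (simp add: n_def l'_def mult.commute)
  have "holonomy p u v (transport u l n v)" "holonomy q v w (transport v l' n w)"
    using al al' u v w by (auto simp: holonomy_def)
  then have g: "g = transport u l n v" and g': "g' = transport v l' n w"
    using holonomy_unique[OF p(1) p(2)] holonomy_unique[OF q(1) q(2)] by auto
  have first: "transport u L i z = transport u l i z" if "i \<le> n" for i z
    using that by (induction i arbitrary: z) (auto simp: L_def)
  have gc: "g \<in> carrier F" using holonomy_closed[OF p] .
  have second: "transport u L (n + i) z = g \<otimes> transport v l' i z"
    if "i \<le> n" "z \<in> support (q (i / n))" for i z
    using that
  proof (induction i arbitrary: z)
    case 0
    then show ?case
      using first[of n z] transport_change[OF p(1) u al, of n v z] v n pq g by simp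
  next
    case (Suc i)
    have i: "i < n" "real (Suc i) / n \<in> {0..1}" using Suc.prems by auto
    note a = adaptedD[OF al' i(1)]
    have "{l' i, z} \<in> H"
      using support_face[OF q(1)[OF i(2)]] a Suc.prems by auto
    moreover have "transport v l' i (l' i) \<in> carrier F"
      using transport_change[OF q(1) v(2) al'] i(1) a by auto
    moreover have "L (n + i) = l' i" by (simp add: L_def)
    ultimately show ?case
      using Suc.IH[of "l' i"] i(1) a gc by (simp add: m_assoc c_closed)
  qed
  have "transport u L (2 * n) w = g \<otimes> g'"
    using second[of n w] w n g' by (simp add: mult_2)
  moreover have "adapted (p +++ q) (2 * n) L"
    unfolding L_def using adapted_join[OF al al' pq] .
  moreover have "(p +++ q) 0 = p 0" "(p +++ q) 1 = q 1"
    by (auto simp: joinpaths_def)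
  ultimately have "\<exists>n l. adapted (p +++ q) n l \<and> g \<otimes> g' = transport u l n w"
    by metis
  then show ?thesis
    using u w \<open>(p +++ q) 0 = p 0\<close> \<open>(p +++ q) 1 = q 1\<close> by (simp add: holonomy_def)
qed

text \<open>The stages \<open>j / n\<close> and \<open>(j + 1) / n\<close> of the homotopy share the
  labelling \<open>l j\<close> and hence the transported value; uniqueness at each stage passes
  \<open>g\<close> on to the next.\<close>

lemma holonomy_homotopic:
  assumes hom: "homotopic_paths S p q" and g: "holonomy p u v g"
  shows "holonomy q u v g"
proof -
  obtain h :: "real \<times> real \<Rightarrow> 'a \<Rightarrow> real" where h: "continuous_on ({0..1} \<times> {0..1}) h" "h \<in> {0..1} \<times> {0..1} \<rightarrow> S"
    and h0: "\<And>t. t \<in> {0..1} \<Longrightarrow> h (0, t) = p t" and h1: "\<And>t. t \<in> {0..1} \<Longrightarrow> h (1, t) = q t"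
    and ends: "\<And>s. s \<in> {0..1} \<Longrightarrow> h (s, 0) = p 0 \<and> h (s, 1) = p 1"
    using hom unfolding homotopic_paths
    by (elim exE conjE, intro that) (auto simp: pathstart_def pathfinish_def)
  obtain n l where n: "0 < n"
    "\<And>j s. j < n \<Longrightarrow> real j \<le> s * n \<Longrightarrow> s * n \<le> real j + 1 \<Longrightarrow> adapted (\<lambda>t. h (s, t)) n (l j)"
    using adapted_grid[OF h] by metis
  \<comment> \<open>The boundary stages of \<open>h\<close> agree with \<open>p\<close> and
    \<open>q\<close> on the unit interval only.\<close>
  have cong: "holonomy a u v g \<Longrightarrow> holonomy b u v g" if "\<And>t. t \<in> {0..1} \<Longrightarrow> a t = b t" for a b
  proof -
    have "adapted a m k \<longleftrightarrow> adapted b m k" for m k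
    proof -
      have "t \<in> {0..1}" if "real i \<le> t * m" "t * m \<le> real i + 1" "i < m" for i and t :: real
      proof -
        have "real i + 1 \<le> 1 * real m" "0 * real m \<le> t * m" using that by auto
        then have t: "0 * real m \<le> t * m" "t * m \<le> 1 * real m"
          using that by (blast intro: order_trans)+
        show ?thesis
          using mult_right_le_imp_le[OF t(1)] mult_right_le_imp_le[OF t(2)] that(3) by simp
      qed
      then have "a t = b t" if "real i \<le> t * m" "t * m \<le> real i + 1" "i < m" for i and t :: real
        using that \<open>\<And>t. t \<in> {0..1} \<Longrightarrow> a t = b t\<close> by blast
      then show ?thesis
        unfolding adapted_def by metis
    qed
    then show "holonomy a u v g \<Longrightarrow> holonomy b u v g"
      using that[of 0] that[of 1] by (auto simp: holonomy_def)
  qed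
  have hS: "h (s, t) \<in> S" if "s \<in> {0..1}" "t \<in> {0..1}" for s t
    using h(2) that by auto
  have "holonomy (\<lambda>t. h (real j / n, t)) u v g" if "j \<le> n" for j
    using that
  proof (induction j)
    case 0
    show ?case
      using cong[of p "\<lambda>t. h (0, t)"] h0 g by simp
  next
    case (Suc j)
    have j: "real j / n \<in> {0..1}" "real (Suc j) / n \<in> {0..1}" using Suc.prems by auto
    have uv: "u \<in> support (p 0)" "v \<in> support (p 1)" using g by (auto simp: holonomy_def)
    have "adapted (\<lambda>t. h (real j / n, t)) n (l j)" "adapted (\<lambda>t. h (real (Suc j) / n, t)) n (l j)"
      using n Suc.prems by auto
    then have "holonomy (\<lambda>t. h (real j / n, t)) u v (transport u (l j) n v)"
      "holonomy (\<lambda>t. h (real (Suc j) / n, t)) u v (transport u (l j) n v)"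
      using uv ends[OF j(1)] ends[OF j(2)] unfolding holonomy_def by auto
    moreover have "g = transport u (l j) n v"
      using holonomy_unique[OF hS[OF j(1)] Suc.IH] calculation Suc.prems by auto
    ultimately show ?case by simp
  qed
  from this[of n] have "holonomy (\<lambda>t. h (1, t)) u v g" using n(1) by simp
  then show ?thesis
    using cong[of "\<lambda>t. h (1, t)" q] h1 by simp
qed

lemma holonomy_in_star:
  assumes "\<And>t. t \<in> {0..1} \<Longrightarrow> v \<in> support (p t)" "p 0 \<in> S"
  shows "holonomy p v v \<one>"
proof -
  have "v \<in> V"
    using assms(1)[of 0] assms(2) face_subset by (auto simp: realization_iff)
  moreover have "adapted p 1 (\<lambda>_. v)"
    using assms by (auto simp: adapted_def)
  ultimately show ?thesis
    using assms unfolding holonomy_def by (auto intro!: exI[of _ 1] exI[of _ "\<lambda>_. v"] simp: c_refl)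
qed

lemma holonomy_edge:
  assumes "{u, v} \<in> H"
  shows "holonomy (segment (vertex_point u) (vertex_point v)) u v (c u v)"
proof -
  let ?l = "\<lambda>i::nat. if i = 0 then u else v"
  have uv: "u \<in> V" "v \<in> V" using assms face_subset by auto
  \<comment> \<open>The closed first half lies in the star of \<open>u\<close>, the closed second
    half in that of \<open>v\<close>.\<close>
  have "adapted (segment (vertex_point u) (vertex_point v)) 2 ?l"
    by (auto simp: adapted_def support_def segment_def vertex_point_def less_2_cases_iff)
  moreover have "c u v = transport u ?l 2 v"
    using assms uv by (simp add: numeral_2_eq_2 c_refl c_closed)
  ultimately show ?thesis
    unfolding holonomy_def by (auto simp: support_def segment_def vertex_point_def)
qed

end

section \<open>The fundamental group and edge paths\<close>

context based_complex
begin

text \<open>The tautological cocycle, with values in the fundamental group itself.\<close>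

definition edge_class :: "'a \<Rightarrow> 'a \<Rightarrow> (real \<Rightarrow> 'a \<Rightarrow> real) set" where
  "edge_class u v = \<Theta> (segment (vertex_point u) (vertex_point v))"

sublocale edge: cocycle V H G edge_class
proof unfold_locales
  show "edge_class u v \<in> carrier G" if "{u, v} \<in> H" for u v
    using \<Theta>_carrier[OF path_between_edge[OF that]] by (simp add: edge_class_def)
  show "edge_class u v \<otimes>\<^bsub>G\<^esub> edge_class v w = edge_class u w" if "{u, v, w} \<in> H" for u v w
    unfolding edge_class_def using that face_subset[OF that]
    by (intro \<Theta>_segment_triangle) (auto simp: vertex_point_in insert_commute)
qed

text \<open>Each piece of the path stays in one star and may be replaced by the way through its
  centre. At a subdivision point the way out of that centre, followed by the way to the next vertex,
  is homotopic to an edge, so the product telescopes.\<close>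

lemma \<Theta>_transport:
  assumes p: "path_between S y z p" and b: "b \<in> support y" and l: "adapted p n l"
  shows "i \<le> n \<Longrightarrow> w \<in> support (p (i / n)) \<Longrightarrow>
    \<Theta> (p \<circ> linepath 0 (i / n)) \<otimes>\<^bsub>G\<^esub> \<Theta> (segment (p (i / n)) (vertex_point w))
      = \<Theta> (segment y (vertex_point b)) \<otimes>\<^bsub>G\<^esub> edge.transport b l i w"
proof (induction i arbitrary: w)
  case 0
  have y: "p 0 = y" "y \<in> S"
    using p path_between_ends[OF p] by (auto simp: path_between_def pathstart_def)
  have w: "w \<in> support y" using 0 y by simp
  have "{b, w} \<subseteq> V" using b w y support_face[of y] face_subset by blast
  have "p \<circ> linepath 0 (real 0 / n) = (\<lambda>_. y)"
    using y by (auto simp: fun_eq_iff)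
  moreover have "\<Theta> (segment y (vertex_point b)) \<otimes>\<^bsub>G\<^esub> edge_class b w = \<Theta> (segment y (vertex_point w))"
    unfolding edge_class_def using b w y \<open>{b, w} \<subseteq> V\<close> by (intro \<Theta>_segment_triangle) (auto simp: vertex_point_in support_face insert_absorb)
  moreover have "\<Theta> (segment y (vertex_point w)) \<in> carrier G"
    using w y \<open>{b, w} \<subseteq> V\<close>
    by (intro \<Theta>_carrier[OF path_between_segment]) (auto simp: vertex_point_in support_face insert_absorb)
  ultimately show ?case
    using y by (simp add: \<Theta>_const)
next
  case (Suc i)
  define a where "a = real i / n"
  define a' where "a' = real (Suc i) / n"
  have i: "i < n" and aI: "a \<in> {0..1}" "a' \<in> {0..1}" using Suc.prems by (auto simp: a_def a'_def)
  have pS: "p t \<in> S" if "t \<in> {0..1}" for t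
    using p that by (auto simp: path_between_def path_image_def)
  let ?v = "l i"
  have v: "?v \<in> support (p a)" "?v \<in> support (p a')"
    using adaptedD[OF l i] by (auto simp: a_def a'_def)
  have w: "w \<in> support (p a')" using Suc.prems by (simp add: a'_def)
  have paS: "p a \<in> S" "p a' \<in> S" using pS aI by auto
  have V: "?v \<in> V" "w \<in> V"
    using v w pS[OF aI(2)] support_face face_subset by blast+
  have star: "?v \<in> support ((p \<circ> linepath a a') t)" if "t \<in> {0..1}" for t
  proof -
    have "linepath a a' t \<in> closed_segment a a'"
      using that linepath_in_path by blast
    then have "a \<le> linepath a a' t" "linepath a a' t \<le> a'"
      by (auto simp: closed_segment_eq_real_ivl a_def a'_def divide_right_mono split: if_splits)
    then have "real i \<le> linepath a a' t * n" "linepath a a' t * n \<le> real i + 1"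
      using i by (simp_all add: a_def a'_def field_simps)
    then show ?thesis
      using l i by (simp add: adapted_def)
  qed
  have pa: "path_between S (p 0) (p a) (p \<circ> linepath 0 a)" "path_between S (p a) (p a') (p \<circ> linepath a a')"
    using p aI path_compose_linepath[of p S 0 a] path_compose_linepath[of p S a a'] by (auto simp: path_between_def)
  have sv: "path_between S (p a) (vertex_point ?v) (segment (p a) (vertex_point ?v))"
    "path_between S (vertex_point ?v) (p a') (segment (vertex_point ?v) (p a'))"
    "path_between S (p a') (vertex_point w) (segment (p a') (vertex_point w))"
    using v w V paS by (auto intro!: path_between_segment simp: vertex_point_in support_face insert_absorb)
  note closed = \<Theta>_carrier[OF pa(1)] \<Theta>_carrier[OF pa(2)] \<Theta>_carrier[OF sv(1)] \<Theta>_carrier[OF sv(2)] \<Theta>_carrier[OF sv(3)]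
  have pre: "\<Theta> (p \<circ> linepath 0 a) \<otimes>\<^bsub>G\<^esub> \<Theta> (p \<circ> linepath a a') = \<Theta> (p \<circ> linepath 0 a')"
    using p aI by (intro \<Theta>_triangle[of "{0..1}"]) (auto simp: path_between_def path_def path_image_def)
  have star': "\<Theta> (p \<circ> linepath a a') = \<Theta> (segment (p a) (vertex_point ?v)) \<otimes>\<^bsub>G\<^esub> \<Theta> (segment (vertex_point ?v) (p a'))"
    using \<Theta>_in_star[OF pa(2) star] .
  have out: "\<Theta> (segment (vertex_point ?v) (p a')) \<otimes>\<^bsub>G\<^esub> \<Theta> (segment (p a') (vertex_point w)) = edge_class ?v w"
    unfolding edge_class_def using v w V paS
    by (intro \<Theta>_segment_triangle) (auto simp: vertex_point_in support_face insert_absorb)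
  have IH: "\<Theta> (p \<circ> linepath 0 a) \<otimes>\<^bsub>G\<^esub> \<Theta> (segment (p a) (vertex_point ?v))
      = \<Theta> (segment y (vertex_point b)) \<otimes>\<^bsub>G\<^esub> edge.transport b l i ?v"
    using Suc.IH[of ?v] i v(1) unfolding a_def by (simp only: less_imp_le)
  have y: "y \<in> S" "p 0 = y"
    using p path_between_ends[OF p] by (auto simp: path_between_def pathstart_def)
  have "b \<in> V" using b y support_face face_subset by blast
  then have yb: "\<Theta> (segment y (vertex_point b)) \<in> carrier G"
    using b y by (intro \<Theta>_carrier[OF path_between_segment]) (auto simp: vertex_point_in support_face insert_absorb)
  have tr: "edge.transport b l i ?v \<in> carrier G"
    using edge.transport_change[OF pS _ l, of b i ?v ?v] i v b y by (simp add: a_def)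
  have ec: "edge_class ?v w \<in> carrier G"
    using support_face[OF pS[OF aI(2)]] v w by (intro edge.c_closed) auto
  have "\<Theta> (p \<circ> linepath 0 a') \<otimes>\<^bsub>G\<^esub> \<Theta> (segment (p a') (vertex_point w))
      = \<Theta> (p \<circ> linepath 0 a) \<otimes>\<^bsub>G\<^esub> \<Theta> (segment (p a) (vertex_point ?v)) \<otimes>\<^bsub>G\<^esub>
        (\<Theta> (segment (vertex_point ?v) (p a')) \<otimes>\<^bsub>G\<^esub> \<Theta> (segment (p a') (vertex_point w)))"
    using closed by (simp add: pre[symmetric] star' pi1.m_assoc)
  also have "\<dots> = \<Theta> (segment y (vertex_point b)) \<otimes>\<^bsub>G\<^esub> edge.transport b l (Suc i) w"
    using out IH yb tr ec by (simp add: pi1.m_assoc)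
  finally show ?case
    unfolding a'_def .
qed

lemma loop_class_eq_one_if_transport:
  assumes p: "p \<in> loops_at S x" and b: "b \<in> support x" and l: "adapted p n l"
    and one: "edge.transport b l n b = \<one>\<^bsub>G\<^esub>"
  shows "loop_class S p = \<one>\<^bsub>G\<^esub>"
proof (rule loop_class_eq_one_if_\<Theta>[OF p])
  have pb: "path_between S x x p" using p by (simp add: loops_at_path_between)
  have n: "0 < n" using l by (simp add: adapted_def)
  have p1: "p 1 = x" using pb by (simp add: path_between_def pathfinish_def)
  have "b \<in> V" using b x support_face face_subset by blast
  then have xb: "\<Theta> (segment x (vertex_point b)) \<in> carrier G"
    using b x by (intro \<Theta>_carrier[OF path_between_segment]) (auto simp: vertex_point_in support_face insert_absorb)
  have "\<Theta> p \<otimes>\<^bsub>G\<^esub> \<Theta> (segment x (vertex_point b)) = \<Theta> (segment x (vertex_point b))"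
    using \<Theta>_transport[OF pb b l, of n b] n p1 b one xb by (simp add: linepath_real_01)
  then show "\<Theta> p = \<one>\<^bsub>G\<^esub>"
    using \<Theta>_carrier[OF pb] xb by (simp add: pi1.l_cancel_one')
qed

end

section \<open>Comparison of the fundamental group with the coefficient group\<close>

locale based_cocycle = based_complex V H x \<tau> + cocycle V H F c
  for V :: "'a set" and H x \<tau> and F (structure) and c
begin

lemma path_between_in: "path_between S y z p \<Longrightarrow> t \<in> {0..1} \<Longrightarrow> p t \<in> S"
  by (auto simp: path_between_def path_image_def)

definition \<Phi> :: "'a \<Rightarrow> (real \<Rightarrow> 'a \<Rightarrow> real) set \<Rightarrow> 'b" where
  "\<Phi> b P = (THE g. \<exists>p\<in>P. holonomy p b b g)"

lemma \<Phi>_loop_class: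
  assumes p: "p \<in> loops_at S x" and g: "holonomy p b b g"
  shows "\<Phi> b (loop_class S p) = g"
  unfolding \<Phi>_def
proof (rule the_equality)
  have "p \<in> loop_class S p"
    using p by (simp add: loop_class_def loops_at_def)
  then show "\<exists>q\<in>loop_class S p. holonomy q b b g"
    using g by blast
  fix g' assume "\<exists>q\<in>loop_class S p. holonomy q b b g'"
  then obtain q where "homotopic_paths S p q" "holonomy q b b g'"
    by (auto simp: loop_class_def)
  then have "holonomy p b b g'"
    using holonomy_homotopic homotopic_paths_sym by blast
  then show "g' = g"
    using holonomy_unique[OF _ _ g] path_between_in p by (auto simp: loops_at_path_between)
qed

text \<open>Holonomy is the isomorphism. By \<open>hc\<close>, \<open>h\<close> turns the cocycle
  \<open>c\<close> into the tautological one up to the gauge \<open>k\<close>, so trivial holonomy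
  forces trivial tautological transport and the loop is null-homotopic. The image is a subgroup that
  contains the generating set \<open>A\<close>.\<close>

lemma fundamental_group_iso:
  assumes b: "b \<in> support x" and h: "h \<in> hom F G"
    and k: "\<And>v. v \<in> V \<Longrightarrow> k v \<in> carrier G"
    and hc: "\<And>u v. {u, v} \<in> H \<Longrightarrow> h (c u v) = k u \<otimes>\<^bsub>G\<^esub> edge_class u v \<otimes>\<^bsub>G\<^esub> inv\<^bsub>G\<^esub> k v"
    and gen: "\<And>K. subgroup K F \<Longrightarrow> A \<subseteq> K \<Longrightarrow> carrier F \<subseteq> K"
    and loops: "\<And>a. a \<in> A \<Longrightarrow> \<exists>p\<in>loops_at S x. holonomy p b b a"
  shows "G \<cong> F"
proof -
  interpret h: group_hom F G h
    using h by unfold_locales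
  have bV: "b \<in> V" using b x support_face face_subset by blast
  have carr: "carrier G = loop_class S ` loops_at S x"
    by (simp add: fundamental_group_def)
  have ends: "p 0 = x" "p 1 = x" if "p \<in> loops_at S x" for p
    using that by (auto simp: loops_at_def pathstart_def pathfinish_def)
  have inS: "p t \<in> S" if "p \<in> loops_at S x" "t \<in> {0..1}" for p t
    using that path_between_in by (auto simp: loops_at_path_between)
  have ex: "\<exists>n l. adapted p n l \<and> holonomy p b b (transport b l n b)" if "p \<in> loops_at S x" for p
    by (rule holonomy_exists[of p b b]) (use that b ends[OF that] in \<open>auto simp: loops_at_def\<close>)
  have rep: "\<exists>p n l. p \<in> loops_at S x \<and> P = loop_class S p \<and> adapted p n l \<and> holonomy p b b (transport b l n b)"
    if "P \<in> carrier G" for P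
    using that ex unfolding carr by blast
  \<comment> \<open>The gauge factors at intermediate vertices cancel; for a loop with
    \<open>w = b\<close> a conjugation by \<open>k b\<close> remains.\<close>
  have h_transport: "h (transport b l i w) = k b \<otimes>\<^bsub>G\<^esub> edge.transport b l i w \<otimes>\<^bsub>G\<^esub> inv\<^bsub>G\<^esub> k w"
    if p: "p \<in> loops_at S x" and l: "adapted p n l" and "i \<le> n" "w \<in> support (p (i / n))" for p n l i w
    using that(3,4)
  proof (induction i arbitrary: w)
    case 0
    have "{b, w} \<in> H"
      using 0 support_face[OF x] b ends[OF p] by auto
    then show ?case by (simp add: hc)
  next
    case (Suc i)
    have i: "i < n" "real (Suc i) / n \<in> {0..1}" using Suc.prems by auto
    note a = adaptedD[OF l i(1)]
    have H: "{l i, w} \<in> H"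
      using support_face[OF inS[OF p i(2)]] a Suc.prems by auto
    then have V: "l i \<in> V" "w \<in> V" using face_subset by auto
    have "transport b l i (l i) \<in> carrier F"
      using transport_change[OF inS[OF p] _ l] i(1) a b ends[OF p] by auto
    moreover have "edge.transport b l i (l i) \<in> carrier G"
      using edge.transport_change[OF inS[OF p] _ l] i(1) a b ends[OF p] by auto
    moreover have "inv\<^bsub>G\<^esub> k (l i) \<otimes>\<^bsub>G\<^esub> (k (l i) \<otimes>\<^bsub>G\<^esub> z) = z" if "z \<in> carrier G" for z
      using that k[OF V(1)] by (simp add: pi1.m_assoc[symmetric])
    ultimately show ?case
      using Suc.IH[of "l i"] i(1) a H c_closed[OF H] edge.c_closed[OF H] k V bV
      by (simp add: hc pi1.m_assoc)
  qed
  have hom: "\<Phi> b \<in> hom G F"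
  proof (rule homI)
    fix P assume "P \<in> carrier G"
    then obtain p n l where p: "p \<in> loops_at S x" "P = loop_class S p" "holonomy p b b (transport b l n b)"
      using rep by blast
    then show "\<Phi> b P \<in> carrier F"
      using \<Phi>_loop_class holonomy_closed inS by metis
    fix Q assume "Q \<in> carrier G"
    then obtain q m l' where q: "q \<in> loops_at S x" "Q = loop_class S q" "holonomy q b b (transport b l' m b)"
      using rep by blast
    have "holonomy (p +++ q) b b (transport b l n b \<otimes> transport b l' m b)"
      using p q inS ends by (intro holonomy_join) auto
    then show "\<Phi> b (P \<otimes>\<^bsub>G\<^esub> Q) = \<Phi> b P \<otimes> \<Phi> b Q"
      using \<Phi>_loop_class[OF loops_at_join[OF p(1) q(1)]] \<Phi>_loop_class[OF p(1,3)] \<Phi>_loop_class[OF q(1,3)] p q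
      by (simp add: fundamental_group_mult)
  qed
  then interpret \<Phi>: group_hom G F "\<Phi> b"
    by unfold_locales
  have "P = \<one>\<^bsub>G\<^esub>" if P: "P \<in> carrier G" and 1: "\<Phi> b P = \<one>" for P
  proof -
    obtain p n l where p: "p \<in> loops_at S x" "P = loop_class S p"
      and l: "adapted p n l" "holonomy p b b (transport b l n b)"
      using rep[OF P] by blast
    have n: "0 < n" using l by (simp add: adapted_def)
    have bs: "b \<in> support (p (real n / n))" using b ends[OF p(1)] n by simp
    have tc: "edge.transport b l n b \<in> carrier G"
      using edge.transport_change[OF inS[OF p(1)] _ l(1)] bs b ends[OF p(1)] by auto
    have "transport b l n b = \<one>"
      using \<Phi>_loop_class[OF p(1) l(2)] 1 p(2) by simp
    then have "k b \<otimes>\<^bsub>G\<^esub> edge.transport b l n b \<otimes>\<^bsub>G\<^esub> inv\<^bsub>G\<^esub> k b = \<one>\<^bsub>G\<^esub>"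
      using h_transport[OF p(1) l(1), of n b] bs by simp
    then have "k b \<otimes>\<^bsub>G\<^esub> edge.transport b l n b = k b"
      using tc k[OF bV] pi1.inv_equality[of "k b \<otimes>\<^bsub>G\<^esub> edge.transport b l n b" "inv\<^bsub>G\<^esub> k b"] by simp
    then have "edge.transport b l n b = \<one>\<^bsub>G\<^esub>"
      using tc k[OF bV] by (simp add: pi1.l_cancel_one)
    then show ?thesis
      using loop_class_eq_one_if_transport[OF p(1) b l(1)] p(2) by simp
  qed
  then have "inj_on (\<Phi> b) (carrier G)"
    by (simp add: \<Phi>.inj_on_one_iff)
  moreover have "carrier F \<subseteq> \<Phi> b ` carrier G"
  proof (rule gen[OF \<Phi>.img_is_subgroup])
    show "A \<subseteq> \<Phi> b ` carrier G"
    proof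
      fix a assume "a \<in> A"
      then obtain p where "p \<in> loops_at S x" "holonomy p b b a" using loops by blast
      then show "a \<in> \<Phi> b ` carrier G"
        using \<Phi>_loop_class[of p b a] carr by force
    qed
  qed
  ultimately have "\<Phi> b \<in> iso G F"
    using hom \<Phi>.hom_closed by (auto simp: iso_def bij_betw_def)
  then show ?thesis
    unfolding is_iso_def by blast
qed

end

section \<open>Flats of boolean representable complexes\<close>

lemma matrix_independentE:
  assumes "matrix_independent R M X"
  obtains Y n ys xs where "Y \<subseteq> R" "bij_betw ys {..<n} Y" "bij_betw xs {..<n} X"
    "\<forall>i<n. M (ys i) (xs i)" "\<forall>j<(n::nat). \<forall>i<j. \<not> M (ys i) (xs j)"
proof -
  obtain Y where Y: "Y \<subseteq> R" "nonsingular_submatrix M Y X"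
    using assms by (auto simp: matrix_independent_def)
  show ?thesis
    using Y(2) unfolding nonsingular_submatrix_def
    by (elim exE conjE, intro that[OF Y(1)])
qed

text \<open>Row \<open>y\<close> and column \<open>p\<close> are put in front, at index 0: since
  \<open>y\<close> vanishes on \<open>X\<close>, the new first row is zero to the right of the
  diagonal.\<close>

lemma matrix_independent_insert:
  assumes X: "matrix_independent R M X" and y: "y \<in> R" "M y p" "\<And>v. v \<in> X \<Longrightarrow> \<not> M y v"
  shows "matrix_independent R M (insert p X)"
proof -
  obtain Y ys xs and n :: nat where Y: "Y \<subseteq> R" and b: "bij_betw ys {..<n} Y" "bij_betw xs {..<n} X"
    and diag: "\<forall>i<n. M (ys i) (xs i)" and above: "\<forall>j<n. \<forall>i<j. \<not> M (ys i) (xs j)"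
    using X by (rule matrix_independentE)
  have X_eq: "X = xs ` {..<n}" "Y = ys ` {..<n}" using b by (auto simp: bij_betw_def)
  have "y \<notin> Y" "p \<notin> X"
    using diag y(2,3) by (auto simp: X_eq)
  have shift: "bij_betw (case_nat a f) {..<Suc n} (insert a A)"
    if "bij_betw f {..<n} A" "a \<notin> A" for a and f :: "nat \<Rightarrow> 'z" and A
  proof -
    have "{..<Suc n} = insert 0 (Suc ` {..<n})" by (auto simp: less_Suc_eq_0_disj)
    moreover have "inj_on (case_nat a f) (insert 0 (Suc ` {..<n}))"
      using that by (auto simp: inj_on_def bij_betw_def)
    ultimately show ?thesis
      using that by (auto simp: bij_betw_def image_image)
  qed
  have "nonsingular_submatrix M (insert y Y) (insert p X)"
    unfolding nonsingular_submatrix_def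
  proof (intro exI conjI allI impI)
    show "bij_betw (case_nat y ys) {..<Suc n} (insert y Y)" "bij_betw (case_nat p xs) {..<Suc n} (insert p X)"
      using b \<open>y \<notin> Y\<close> \<open>p \<notin> X\<close> by (auto intro!: shift)
    show "M (case_nat y ys i) (case_nat p xs i)" if "i < Suc n" for i
      using that diag y(2) by (cases i) auto
    show "\<not> M (case_nat y ys i) (case_nat p xs j)" if "j < Suc n" "i < j" for i j
      using that above y(3) by (cases i; cases j) (auto simp: X_eq)
  qed
  then show ?thesis
    using Y y(1) unfolding matrix_independent_def by (intro exI[of _ "insert y Y"]) auto
qed

text \<open>The zero set of any row is a flat, because that row can be put in front of the
  triangular form of a face inside it. In the triangular form of \<open>X\<close> the first row
  vanishes on all columns but the first, which is the vertex \<open>y\<close>.\<close>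

lemma boolean_representable_flat:
  assumes br: "boolean_representable V H" and X: "X \<in> H" "X \<noteq> {}"
  obtains y F where "y \<in> X" "F \<in> flats V H" "X - {y} \<subseteq> F" "y \<notin> F"
proof -
  obtain R :: "nat set" and M where H: "H = {X. X \<subseteq> V \<and> matrix_independent R M X}"
    using br by (auto simp: boolean_representable_def)
  obtain Y ys xs and n :: nat where Y: "Y \<subseteq> R" and b: "bij_betw ys {..<n} Y" "bij_betw xs {..<n} X"
    and diag: "\<forall>i<n. M (ys i) (xs i)" and above: "\<forall>j<n. \<forall>i<j. \<not> M (ys i) (xs j)"
    using X(1) unfolding H by (auto elim: matrix_independentE)
  have X_eq: "X = xs ` {..<n}" "Y = ys ` {..<n}" using b by (auto simp: bij_betw_def)
  then have n: "0 < n" using X(2) by auto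
  define F where "F = {v \<in> V. \<not> M (ys 0) v}"
  have R: "ys 0 \<in> R" using Y n by (auto simp: X_eq)
  have "F \<in> flats V H"
    unfolding flats_def
  proof (intro CollectI conjI ballI impI)
    fix I p assume I: "I \<in> H" "I \<subseteq> F" and p: "p \<in> V - F"
    have "matrix_independent R M (insert p I)"
      using I p R by (intro matrix_independent_insert[of R M I "ys 0"]) (auto simp: H F_def)
    then show "I \<union> {p} \<in> H"
      using I p by (auto simp: H)
  qed (auto simp: F_def)
  moreover have "X - {xs 0} \<subseteq> F"
  proof
    fix v assume v: "v \<in> X - {xs 0}"
    then obtain j where "j < n" "v = xs j" by (auto simp: X_eq)
    then show "v \<in> F"
      using v above X(1) by (cases j) (auto simp: F_def H)
  qed
  ultimately show ?thesis
    using n diag by (intro that[of "xs 0" F]) (auto simp: F_def X_eq)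
qed

section \<open>Parallel vertices and the graph of flats\<close>

locale br_complex = simplicial_complex V H for V :: "'a set" and H +
  assumes br: "boolean_representable V H" and dim: "\<exists>X\<in>H. 3 \<le> card X"
begin

abbreviation E :: "('a \<times> 'a) set" where
  "E \<equiv> flat_graph_edges V H"

text \<open>Since \<open>V\<close> is itself a flat, the closure is an intersection of subsets of
  \<open>V\<close>, and it is proper exactly if one of the flats is.\<close>

lemma E_iff: "(p, q) \<in> E \<longleftrightarrow> p \<noteq> q \<and> (\<exists>F\<in>flats V H. p \<in> F \<and> q \<in> F \<and> F \<noteq> V)"
  by (auto simp: flat_graph_edges_def flat_closure_def flats_def) blast+

lemma flat_subset: "F \<in> flats V H \<Longrightarrow> F \<subseteq> V"
  by (auto simp: flats_def)

lemma flat_extend: "F \<in> flats V H \<Longrightarrow> I \<in> H \<Longrightarrow> I \<subseteq> F \<Longrightarrow> p \<in> V \<Longrightarrow> p \<notin> F \<Longrightarrow> insert p I \<in> H"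
  unfolding flats_def by fastforce

lemma E_in: "(p, q) \<in> E \<Longrightarrow> p \<in> V \<and> q \<in> V"
  using flat_subset by (auto simp: E_iff)

text \<open>A flat separates \<open>p\<close> from \<open>r\<close>. As \<open>{p, q}\<close> is no
  face, the flat cannot separate \<open>p\<close> from \<open>q\<close>, hence it separates
  \<open>q\<close> from \<open>r\<close>. So parallel vertices have the same neighbours.\<close>

lemma nonface_split:
  assumes "{p, r} \<in> H" "p \<noteq> r" "q \<in> V" "{p, q} \<notin> H"
  shows "{q, r} \<in> H"
proof -
  obtain y F where y: "y \<in> {p, r}" and F: "F \<in> flats V H" "{p, r} - {y} \<subseteq> F" "y \<notin> F"
    using boolean_representable_flat[OF br assms(1)] by blast
  have V: "p \<in> V" "r \<in> V" "{q} \<in> H" "{p} \<in> H" "{r} \<in> H"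
    using assms face_subset vertex_face by auto
  show ?thesis
  proof (cases "y = p")
    case True
    have "q \<notin> F"
      using flat_extend[OF F(1) V(3), of p] F True V assms(4) by auto
    then show ?thesis
      using flat_extend[OF F(1) V(5), of q] F True assms(2,3) by auto
  next
    case False
    then have y: "y = r" "p \<in> F" using y F assms(2) by auto
    have "q \<in> F"
      using flat_extend[OF F(1) V(4), of q] y assms(3,4) by (auto simp: insert_commute)
    then show ?thesis
      using flat_extend[OF F(1) V(3), of r] F y V by (auto simp: insert_commute)
  qed
qed

lemma nonface_in_flat:
  assumes "F \<in> flats V H" "p \<in> F" "q \<in> V" "{p, q} \<notin> H"
  shows "q \<in> F"
  using flat_extend[OF assms(1), of "{p}" q] assms vertex_face[of p] flat_subset
  by (auto simp: insert_commute)

text \<open>The class of vertices parallel to \<open>p\<close> is a proper flat, because it contains no edge.\<close>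

lemma parallel_flat:
  assumes p: "p \<in> V"
  shows "{v \<in> V. v = p \<or> {p, v} \<notin> H} \<in> flats V H" and "{v \<in> V. v = p \<or> {p, v} \<notin> H} \<noteq> V"
proof -
  let ?F = "{v \<in> V. v = p \<or> {p, v} \<notin> H}"
  have sub: "a = b" if "I \<in> H" "I \<subseteq> ?F" "a \<in> I" "b \<in> I" for I a b
  proof (rule ccontr)
    assume "a \<noteq> b"
    have ab: "{a, b} \<in> H" using face_mono[OF that(1)] that by auto
    have "a = p \<or> {p, a} \<notin> H" "b = p \<or> {p, b} \<notin> H" using that by auto
    then have "{p, a} \<notin> H" "{p, b} \<notin> H" using ab \<open>a \<noteq> b\<close> by (auto simp: insert_commute)
    then show False
      using nonface_split[OF ab \<open>a \<noteq> b\<close> p] by (auto simp: insert_commute)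
  qed
  show "?F \<in> flats V H"
    unfolding flats_def
  proof (intro CollectI conjI ballI impI)
    fix I z assume I: "I \<in> H" "I \<subseteq> ?F" and z: "z \<in> V - ?F"
    then have pz: "{p, z} \<in> H" "p \<noteq> z" "z \<in> V" by auto
    show "I \<union> {z} \<in> H"
    proof (cases "I = {}")
      case True
      then show ?thesis using pz vertex_face by simp
    next
      case False
      then obtain a where "I = {a}" using sub[OF I] by blast
      moreover have "{a, z} \<in> H"
        using nonface_split[OF pz(1,2), of a] I \<open>I = {a}\<close> pz by auto
      ultimately show ?thesis by (simp add: insert_commute)
    qed
  qed auto
  obtain X where X: "X \<in> H" "3 \<le> card X" using dim by blast
  show "?F \<noteq> V"
  proof
    assume "?F = V"
    then have "X \<subseteq> ?F" using face_subset[OF X(1)] by simp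
    then have "\<forall>a\<in>X. \<forall>b\<in>X. a = b" using sub[OF X(1)] by blast
    then have "card X \<le> 1" by (cases "finite X") (auto simp: card_le_Suc0_iff_eq)
    then show False using X(2) by simp
  qed
qed

lemma nonface_edge: "p \<in> V \<Longrightarrow> q \<in> V \<Longrightarrow> {p, q} \<notin> H \<Longrightarrow> (p, q) \<in> E"
  using parallel_flat[of p] vertex_face[of p] by (auto simp: E_iff intro!: bexI[of _ "{v \<in> V. v = p \<or> {p, v} \<notin> H}"])

lemma face_edge:
  assumes "{u, v, w} \<in> H" "u \<noteq> v" "u \<noteq> w" "v \<noteq> w"
  shows "(u, v) \<in> E \<or> (u, w) \<in> E \<or> (v, w) \<in> E"
proof -
  obtain y F where y: "y \<in> {u, v, w}" and F: "F \<in> flats V H" "{u, v, w} - {y} \<subseteq> F" "y \<notin> F"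
    using boolean_representable_flat[OF br assms(1)] by blast
  have "y \<in> V" using y face_subset[OF assms(1)] by auto
  then have "F \<noteq> V" using F by blast
  then have E: "(a, b) \<in> E" if "a \<in> F" "b \<in> F" "a \<noteq> b" for a b
    using that F(1) unfolding E_iff by blast
  have "y = u \<or> y = v \<or> y = w" using y by simp
  then have "u \<in> F \<and> v \<in> F \<or> u \<in> F \<and> w \<in> F \<or> v \<in> F \<and> w \<in> F"
    using F(2) assms(2-4) by blast
  then show ?thesis using E assms(2-4) by blast
qed

lemma edge_cone:
  assumes "F \<in> flats V H" "u \<in> F" "v \<in> F" "{u, v} \<in> H" "z \<in> V" "z \<notin> F"
  shows "{u, v, z} \<in> H"
  using flat_extend[OF assms(1,4) _ assms(5,6)] assms by (auto simp: insert_commute)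

section \<open>Components of the graph of flats and their contraction\<close>

definition component :: "'a \<Rightarrow> 'a set" where
  "component u = {v \<in> V. (u, v) \<in> E\<^sup>*}"

definition nontrivial :: "'a \<Rightarrow> bool" where
  "nontrivial u \<longleftrightarrow> H \<inter> nsets (component u) 2 \<noteq> {}"

lemma component_refl: "u \<in> V \<Longrightarrow> u \<in> component u"
  by (simp add: component_def)

lemma E_rtrancl_sym: "(u, v) \<in> E\<^sup>* \<Longrightarrow> (v, u) \<in> E\<^sup>*"
  using sym_rtrancl[OF sym_flat_graph_edges] by (meson symD)

lemma component_eq: "v \<in> component u \<Longrightarrow> component v = component u"
  unfolding component_def using E_rtrancl_sym rtrancl_trans[of _ _ E] by blast

lemma component_eq_iff: "u \<in> V \<Longrightarrow> v \<in> V \<Longrightarrow> component u = component v \<longleftrightarrow> (u, v) \<in> E\<^sup>*"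
  using component_eq[of v u] component_refl[of v] by (auto simp: component_def)

lemma E_component: "(u, v) \<in> E \<Longrightarrow> component u = component v"
  using E_in[of u v] by (auto simp: component_eq_iff)

lemma component_neq_face: "u \<in> V \<Longrightarrow> v \<in> V \<Longrightarrow> component u \<noteq> component v \<Longrightarrow> {u, v} \<in> H"
  using nonface_edge E_component by blast

lemma nontrivial_iff: "nontrivial u \<longleftrightarrow> (\<exists>a\<in>component u. \<exists>b\<in>component u. a \<noteq> b \<and> {a, b} \<in> H)"
proof -
  have "X \<in> nsets (component u) 2 \<longleftrightarrow> (\<exists>a\<in>component u. \<exists>b\<in>component u. a \<noteq> b \<and> X = {a, b})" for X
    by (auto simp: nsets_def card_2_iff)
  then show ?thesis unfolding nontrivial_def disjoint_iff by metis
qed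

lemma nontrivialI: "u \<in> V \<Longrightarrow> v \<in> V \<Longrightarrow> {u, v} \<in> H \<Longrightarrow> u \<noteq> v \<Longrightarrow> component u = component v \<Longrightarrow> nontrivial u"
  unfolding nontrivial_iff using component_refl by blast

definition face_edges :: "('a \<times> 'a) set" where
  "face_edges = {(u, v) \<in> E. {u, v} \<in> H}"

lemma nontrivial_face_edge:
  assumes q: "q \<in> V" and nt: "nontrivial q"
  obtains v where "(q, v) \<in> face_edges"
proof (rule ccontr)
  assume "\<not> thesis"
  then have none: "\<And>v. (q, v) \<in> E \<Longrightarrow> {q, v} \<notin> H"
    using that by (auto simp: face_edges_def)
  \<comment> \<open>Without a face edge at \<open>q\<close>, all that is reachable from
    \<open>q\<close> is \<open>q\<close> or parallel to it: a flat containing a parallel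
    \<open>v\<close> contains \<open>q\<close>, so its other vertices \<open>w\<close> are graph
    neighbours of \<open>q\<close>. A component of mutually parallel vertices has no face
    edge.\<close>
  have "v = q \<or> {q, v} \<notin> H" if "(q, v) \<in> E\<^sup>*" for v
    using that
  proof (induction rule: rtrancl_induct)
    case (step v w)
    from step(2) obtain F where F: "F \<in> flats V H" "v \<in> F" "w \<in> F" "F \<noteq> V" by (auto simp: E_iff)
    have "q \<in> F"
      using step.IH nonface_in_flat[OF F(1,2) q] F(2) by (auto simp: insert_commute)
    then show ?case
      using none[of w] F by (auto simp: E_iff)
  qed simp
  moreover obtain a b where ab: "a \<in> component q" "b \<in> component q" "a \<noteq> b" "{a, b} \<in> H"
    using nt by (auto simp: nontrivial_iff)
  ultimately have "a = q \<or> {q, a} \<notin> H" "b = q \<or> {q, b} \<notin> H"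
    by (auto simp: component_def)
  then show False
    using nonface_split[OF ab(4,3) q] ab by (auto simp: insert_commute)
qed

text \<open>A graph edge between parallel \<open>v\<close> and \<open>w\<close> is bypassed through
  a face neighbour \<open>z\<close> of \<open>v\<close>: a flat containing \<open>v\<close> also
  contains \<open>w\<close>, and \<open>z\<close> is a neighbour of both.\<close>

lemma face_edges_rtrancl:
  assumes "(u, v) \<in> E\<^sup>*" "u \<in> V" "nontrivial u"
  shows "(u, v) \<in> face_edges\<^sup>*"
  using assms(1)
proof (induction rule: rtrancl_induct)
  case (step v w)
  show ?case
  proof (cases "{v, w} \<in> H")
    case True
    then have "(v, w) \<in> face_edges" using step(2) by (simp add: face_edges_def)
    with step.IH show ?thesis by (rule rtrancl_into_rtrancl)
  next
    case False
    have v: "v \<in> V" "w \<in> V" using E_in[OF step(2)] by auto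
    have "component v = component u" using step(1) v assms(2) by (simp add: component_eq_iff E_rtrancl_sym)
    then have "nontrivial v" using assms(3) by (simp add: nontrivial_def)
    then obtain z where z: "(v, z) \<in> face_edges" using nontrivial_face_edge v by blast
    then obtain F where F: "F \<in> flats V H" "v \<in> F" "z \<in> F" "F \<noteq> V" "v \<noteq> z" and vz: "{v, z} \<in> H"
      by (auto simp: face_edges_def E_iff)
    have "w \<in> F" using nonface_in_flat[OF F(1,2) v(2) False] .
    moreover have "{w, z} \<in> H" using nonface_split[OF vz F(5) v(2) False] .
    moreover have "z \<noteq> w" using vz False by auto
    ultimately have "(z, w) \<in> face_edges"
      using F by (auto simp: face_edges_def E_iff insert_commute)
    then show ?thesis
      using step.IH z by (meson rtrancl.rtrancl_into_rtrancl)
  qed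
qed simp

text \<open>The vertex map of the contraction. The choice depends on the component alone and is
  therefore constant on it; vertices of trivial components are kept apart.\<close>

definition rep :: "'a \<Rightarrow> 'a" where
  "rep u = (if nontrivial u then SOME v. v \<in> component u else u)"

lemma rep_in_component: "u \<in> V \<Longrightarrow> rep u \<in> component u"
  using component_refl someI[of "\<lambda>v. v \<in> component u" u] by (auto simp: rep_def)

lemma rep_in: "u \<in> V \<Longrightarrow> rep u \<in> V"
  using rep_in_component by (auto simp: component_def)

lemma component_rep [simp]: "u \<in> V \<Longrightarrow> component (rep u) = component u"
  using component_eq rep_in_component by blast

lemma nontrivial_cong: "component u = component v \<Longrightarrow> nontrivial u = nontrivial v"
  by (simp add: nontrivial_def)

lemma rep_cong: "component u = component v \<Longrightarrow> nontrivial u \<Longrightarrow> rep u = rep v"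
  using nontrivial_cong[of u v] by (simp add: rep_def)

lemma rep_rep [simp]: "u \<in> V \<Longrightarrow> rep (rep u) = rep u"
proof (cases "nontrivial u")
  case True
  assume "u \<in> V"
  then have "component (rep u) = component u" "nontrivial (rep u)"
    using True nontrivial_cong[of "rep u" u] by auto
  then show ?thesis by (rule rep_cong)
next
  case False
  then show ?thesis by (simp add: rep_def)
qed

text \<open>In a trivial component a face has only one vertex, so the two conditions can differ only
  for pairs that are not faces.\<close>

lemma rep_eq_iff:
  assumes "{u, v} \<in> H"
  shows "rep u = rep v \<longleftrightarrow> component u = component v"
proof -
  have uv: "u \<in> V" "v \<in> V" using assms face_subset by auto
  then have "rep u = rep v \<Longrightarrow> component u = component v" by (metis component_rep)
  moreover have "component u = component v \<Longrightarrow> rep u = rep v"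
    using nontrivialI[OF uv assms] rep_cong by blast
  ultimately show ?thesis by blast
qed

lemma rep_face: "{u, v} \<in> H \<Longrightarrow> {rep u, rep v} \<in> H"
  using rep_eq_iff[of u v] face_subset[of "{u, v}"] component_neq_face[of "rep u" "rep v"] vertex_face[of "rep v"]
  by (cases "rep u = rep v") (auto simp: rep_in)

text \<open>The source of freeness: no triangle keeps three distinct vertices under the contraction,
  so its image is a graph.\<close>

lemma face_rep_eq:
  assumes "{u, v, w} \<in> H"
  shows "rep u = rep v \<or> rep u = rep w \<or> rep v = rep w"
proof (cases "u = v \<or> u = w \<or> v = w")
  case False
  moreover have "{u, v} \<in> H" "{u, w} \<in> H" "{v, w} \<in> H"
    using face_mono[OF assms] by auto
  ultimately show ?thesis
    using face_edge[OF assms] E_component rep_eq_iff by blast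
qed auto

text \<open>Supplies the centre of the star. All other representatives lie in components different
  from a nontrivial one, so its representative spans a face with each of them.\<close>

lemma nontrivial_exists: "\<exists>u\<in>V. nontrivial u"
proof -
  obtain X where X: "X \<in> H" "3 \<le> card X" using dim by blast
  obtain T where T: "T \<subseteq> X" "card T = 3"
    using obtain_subset_with_card_n[OF X(2)] by blast
  obtain u v w where uvw: "T = {u, v, w}" "u \<noteq> v" "u \<noteq> w" "v \<noteq> w"
    using iffD1[OF card_3_iff T(2)] by (elim exE conjE, intro that)
  have H: "{u, v, w} \<in> H" using face_mono[OF X(1) T(1)] uvw(1) by simp
  have "{u, v} \<in> H" "{u, w} \<in> H" "{v, w} \<in> H" using face_mono[OF H] by auto
  moreover have "u \<in> V" "v \<in> V" "w \<in> V" using face_subset[OF H] by auto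
  ultimately show ?thesis
    using face_edge[OF H uvw(2-4)] E_component nontrivialI uvw by metis
qed

text \<open>A vertex has a neighbour because its parallel class is proper, and parallel vertices
  share their neighbours.\<close>

lemma edge_path_exists:
  assumes "u \<in> V" "v \<in> V"
  obtains w where "w \<in> V" "{u, w} \<in> H" "{w, v} \<in> H"
proof (cases "{u, v} \<in> H")
  case True
  then show ?thesis using that[of v] assms vertex_face by simp
next
  case False
  obtain w where w: "w \<in> V" "w \<noteq> u" "{u, w} \<in> H"
    using parallel_flat(2)[OF assms(1)] by auto
  then show ?thesis
    using nonface_split[OF w(3) w(2)[symmetric] assms(2) False] that by (simp add: insert_commute)
qed

end

section \<open>Normal form of a cocycle\<close>

locale br_cocycle = br_complex V H + cocycle V H F c
  for V :: "'a set" and H and F (structure) and c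
begin

text \<open>For parallel \<open>q\<close> and \<open>u\<close> there is no edge, and the value is taken along a path through a
  third vertex; it is independent of that vertex if \<open>q\<close> lies in a nontrivial component.\<close>

definition ext_c :: "'a \<Rightarrow> 'a \<Rightarrow> 'b" where
  "ext_c q u = (if {q, u} \<in> H then c q u else
     (let w = SOME w. w \<noteq> q \<and> {q, w} \<in> H in c q w \<otimes> c w u))"

text \<open>The link of \<open>q\<close> is connected, and every vertex of it is joined to both \<open>q\<close> and its parallel \<open>u\<close>.\<close>

lemma parallel_independent:
  assumes q: "q \<in> V" "nontrivial q" and u: "u \<in> V" "{q, u} \<notin> H"
    and x: "x \<noteq> q" "{q, x} \<in> H" and y: "y \<noteq> q" "{q, y} \<in> H"
  shows "c q x \<otimes> c x u = c q y \<otimes> c y u"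
proof -
  have par: "{u, z} \<in> H" if "{q, z} \<in> H" "z \<noteq> q" for z
    using nonface_split[OF that(1) that(2)[symmetric] u] .
  \<comment> \<open>The edge from \<open>a\<close> to \<open>b\<close> closes one triangle with
    \<open>q\<close> and another with \<open>u\<close>.\<close>
  have step: "c q a \<otimes> c a u = c q b \<otimes> c b u"
    if H: "{q, a, b} \<in> H" "{u, a, b} \<in> H" for a b
  proof -
    have f: "{q, a} \<in> H" "{a, b} \<in> H" "{b, u} \<in> H" "{a, b, u} \<in> H"
      using face_mono[OF H(1)] face_mono[OF H(2)] by (auto simp: insert_commute)
    have "c q b \<otimes> c b u = c q a \<otimes> c a b \<otimes> c b u"
      using c_triangle[OF H(1)] by simp
    also have "\<dots> = c q a \<otimes> c a u"
      using f c_triangle[OF f(4)] by (simp add: m_assoc c_closed)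
    finally show ?thesis ..
  qed
  obtain v where v: "(q, v) \<in> face_edges" using nontrivial_face_edge q by blast
  then obtain F' where F: "F' \<in> flats V H" "q \<in> F'" "v \<in> F'" "F' \<noteq> V" "q \<noteq> v" and qv: "{q, v} \<in> H"
    by (auto simp: face_edges_def E_iff)
  have uF: "u \<in> F'" using nonface_in_flat[OF F(1,2) u] .
  \<comment> \<open>The flat contains \<open>q\<close>, its parallel \<open>u\<close> and
    \<open>v\<close>, so a vertex outside cones off both \<open>{q, v}\<close> and
    \<open>{u, v}\<close>.\<close>
  have out: "c q z \<otimes> c z u = c q v \<otimes> c v u" if "z \<in> V" "z \<notin> F'" for z
    using edge_cone[OF F(1,2,3) qv that] edge_cone[OF F(1) uF F(3) par[OF qv F(5)[symmetric]] that]
    by (intro step) (auto simp: insert_commute)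
  have "c q z \<otimes> c z u = c q v \<otimes> c v u" if "{q, z} \<in> H" "z \<noteq> q" for z
  proof (cases "z \<in> F'")
    case True
    \<comment> \<open>Inside the flat the detour is moved first to an outer vertex
      \<open>t\<close>.\<close>
    obtain t where t: "t \<in> V" "t \<notin> F'" using F(4) flat_subset[OF F(1)] by blast
    have "c q z \<otimes> c z u = c q t \<otimes> c t u"
      using edge_cone[OF F(1,2) True that(1) t] edge_cone[OF F(1) uF True par[OF that] t] by (intro step)
    then show ?thesis using out[OF t] by simp
  next
    case False
    then show ?thesis using out face_subset[OF that(1)] by auto
  qed
  then show ?thesis using x y by metis
qed

lemma ext_c_face: "{q, u} \<in> H \<Longrightarrow> ext_c q u = c q u"
  by (simp add: ext_c_def)

lemma ext_c_parallel:
  assumes "q \<in> V" "nontrivial q" "u \<in> V" "{q, u} \<notin> H" "x \<noteq> q" "{q, x} \<in> H"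
  shows "ext_c q u = c q x \<otimes> c x u"
proof -
  define w where "w = (SOME w. w \<noteq> q \<and> {q, w} \<in> H)"
  have "w \<noteq> q \<and> {q, w} \<in> H"
    unfolding w_def using assms(5,6) by (intro someI[of "\<lambda>w. w \<noteq> q \<and> {q, w} \<in> H" x] conjI)
  moreover have "ext_c q u = c q w \<otimes> c w u"
    using assms(4) by (simp add: ext_c_def w_def Let_def)
  ultimately show ?thesis
    using parallel_independent[OF assms(1-4), of w x] assms(5,6) by simp
qed

lemma ext_c_closed:
  assumes "q \<in> V" "nontrivial q \<or> q = u" "u \<in> V"
  shows "ext_c q u \<in> carrier F"
proof (cases "{q, u} \<in> H")
  case True
  then show ?thesis by (simp add: ext_c_face c_closed)
next
  case False
  then have "nontrivial q" using assms vertex_face by auto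
  then obtain v where "(q, v) \<in> face_edges" using nontrivial_face_edge assms by blast
  then have v: "v \<noteq> q" "{q, v} \<in> H" by (auto simp: face_edges_def E_iff)
  have "{u, v} \<in> H" using nonface_split[OF v(2) v(1)[symmetric] assms(3) False] .
  then show ?thesis
    using ext_c_parallel[OF assms(1) \<open>nontrivial q\<close> assms(3) False v] v by (simp add: c_closed insert_commute)
qed

text \<open>If \<open>q\<close> lies outside the flat of \<open>u\<close> and \<open>v\<close>, it
  cones off the edge itself. Otherwise an outer vertex \<open>x\<close> does, and all values of
  \<open>ext_c q\<close> on the flat can be read through \<open>x\<close>: by a triangle for
  neighbours of \<open>q\<close>, by independence of the detour for parallels.\<close>

lemma ext_c_face_edge:
  assumes q: "q \<in> V" "nontrivial q" and uv: "(u, v) \<in> face_edges"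
  shows "ext_c q u \<otimes> c u v = ext_c q v"
proof -
  obtain F' where F: "F' \<in> flats V H" "u \<in> F'" "v \<in> F'" "F' \<noteq> V" and H: "{u, v} \<in> H"
    using uv by (auto simp: face_edges_def E_iff)
  show ?thesis
  proof (cases "q \<in> F'")
    case False
    have "{u, v, q} \<in> H" using edge_cone[OF F(1-3) H q(1) False] .
    then have "{q, u, v} \<in> H" "{q, u} \<in> H" "{q, v} \<in> H"
      using face_mono[of "{u, v, q}"] by (auto simp: insert_commute)
    then show ?thesis by (simp add: ext_c_face c_triangle)
  next
    case True
    obtain x where x: "x \<in> V" "x \<notin> F'" using F(4) flat_subset[OF F(1)] by blast
    have qx: "{q, x} \<in> H" "x \<noteq> q"
      using edge_cone[OF F(1) True True _ x] vertex_face[OF q(1)] x True by auto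
    have ext: "ext_c q w = c q x \<otimes> c x w" if "w \<in> F'" for w
    proof (cases "{q, w} \<in> H")
      case w: True
      have "{q, w, x} \<in> H" using edge_cone[OF F(1) True that w x] .
      then show ?thesis using w c_triangle[of q x w] by (simp add: ext_c_face insert_commute)
    next
      case w: False
      then show ?thesis
        using ext_c_parallel[OF q _ w qx(2,1)] that flat_subset[OF F(1)] by auto
    qed
    have "{u, v, x} \<in> H" using edge_cone[OF F(1-3) H x] .
    then have "{x, u, v} \<in> H" "{x, u} \<in> H"
      using face_mono[of "{u, v, x}"] by (auto simp: insert_commute)
    then show ?thesis
      using qx H by (simp add: ext F m_assoc c_closed c_triangle)
  qed
qed

text \<open>The edge \<open>{u, v}\<close> need not lie in a proper flat, hence the induction along
  a path of face edges: if \<open>v\<close> is outside the flat of the first step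
  \<open>u, w\<close>, then \<open>{u, w, v}\<close> is a face and the claim passes from
  \<open>{w, v}\<close> to \<open>{u, v}\<close>.\<close>

lemma ext_c_component:
  assumes q: "q \<in> V" "nontrivial q" and uv: "(u, v) \<in> face_edges\<^sup>*"
  shows "{u, v} \<in> H \<Longrightarrow> ext_c q u \<otimes> c u v = ext_c q v"
  using uv
proof (induction rule: converse_rtrancl_induct)
  case base
  then have "v \<in> V" using face_subset by auto
  then show ?case using ext_c_closed[OF q(1)] q(2) by (simp add: c_refl)
next
  case (step u w)
  have V: "u \<in> V" "v \<in> V" "w \<in> V"
    using step E_in face_subset[OF step.prems] by (auto simp: face_edges_def)
  obtain F' where F: "F' \<in> flats V H" "u \<in> F'" "w \<in> F'" "F' \<noteq> V" and H: "{u, w} \<in> H"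
    using step(1) by (auto simp: face_edges_def E_iff)
  consider "u = v" | "u \<noteq> v" "v \<in> F'" | "v \<notin> F'" by blast
  then show ?case
  proof cases
    case 1
    then show ?thesis using V ext_c_closed[OF q(1)] q(2) by (simp add: c_refl)
  next
    case 2
    then have "(u, v) \<in> face_edges" using F step.prems by (auto simp: face_edges_def E_iff)
    then show ?thesis by (rule ext_c_face_edge[OF q])
  next
    case 3
    have f: "{u, w, v} \<in> H" using edge_cone[OF F(1-3) H V(2) 3] .
    then have wv: "{w, v} \<in> H" using face_mono by auto
    have "ext_c q u \<otimes> c u v = ext_c q u \<otimes> c u w \<otimes> c w v"
      using V q ext_c_closed[OF q(1)] H wv c_triangle[OF f] by (simp add: m_assoc c_closed)
    then show ?thesis
      using ext_c_face_edge[OF q step(1)] step.IH[OF wv] by simp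
  qed
qed

section \<open>The change of gauge\<close>

definition potential :: "'a \<Rightarrow> 'b" where
  "potential u = ext_c (rep u) u"

lemma rep_nontrivial: "u \<in> V \<Longrightarrow> nontrivial (rep u) \<or> rep u = u"
  using nontrivial_cong[of "rep u" u] component_rep[of u] by (cases "nontrivial u") (simp_all, simp add: rep_def)

lemma potential_closed: "u \<in> V \<Longrightarrow> potential u \<in> carrier F"
  using rep_nontrivial[of u] by (simp add: potential_def ext_c_closed rep_in)

lemma potential_rep: "u \<in> V \<Longrightarrow> potential (rep u) = \<one>"
  using vertex_face[of "rep u"] by (simp add: potential_def ext_c_face c_refl rep_in)

lemma potential_same:
  assumes uv: "{u, v} \<in> H" and eq: "rep u = rep v"
  shows "potential u \<otimes> c u v = potential v"
proof -
  have V: "u \<in> V" "v \<in> V" using face_subset[OF uv] by auto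
  show ?thesis
  proof (cases "u = v")
    case True
    then show ?thesis using V by (simp add: c_refl potential_closed)
  next
    case False
    have "component u = component v" using eq rep_eq_iff[OF uv] by simp
    then have nt: "nontrivial u" using nontrivialI[OF V uv False] by simp
    then have "(u, v) \<in> face_edges\<^sup>*"
      using V \<open>component u = component v\<close> by (simp add: face_edges_rtrancl component_eq_iff)
    moreover have "nontrivial (rep u)" using nt nontrivial_cong[of "rep u" u] V by simp
    ultimately show ?thesis
      using ext_c_component[OF rep_in[OF V(1)] _ _ uv] eq by (simp add: potential_def)
  qed
qed

text \<open>A proper flat stays within one component, so \<open>v\<close> is outside every flat used
  on the way from \<open>u\<close> to \<open>rep u\<close> and cones off each step;
  \<open>potential a \<otimes> c a v\<close> is constant along that way.\<close>

lemma potential_cross: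
  assumes V: "u \<in> V" "v \<in> V" and neq: "component u \<noteq> component v"
  shows "potential u \<otimes> c u v = c (rep u) v"
proof (cases "nontrivial u")
  case False
  then have "rep u = u" by (simp add: rep_def)
  then show ?thesis
    using potential_rep[OF V(1)] c_closed[OF component_neq_face[OF V neq]] by simp
next
  case True
  have "(u, rep u) \<in> face_edges\<^sup>*"
    using V True by (intro face_edges_rtrancl) (auto simp: component_eq_iff[symmetric] rep_in)
  then have "potential u \<otimes> c u v = potential (rep u) \<otimes> c (rep u) v"
  proof (induction rule: rtrancl_induct)
    case (step a b)
    obtain F' where F: "F' \<in> flats V H" "a \<in> F'" "b \<in> F'" "F' \<noteq> V" and H: "{a, b} \<in> H" and ab: "(a, b) \<in> E"
      using step(2) by (auto simp: face_edges_def E_iff)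
    have abV: "a \<in> V" "b \<in> V" using E_in[OF ab] by auto
    have "(u, a) \<in> E\<^sup>*"
      using step(1) rtrancl_mono[of face_edges E] by (auto simp: face_edges_def)
    then have "component a = component u" using V abV component_eq_iff by blast
    have "v \<notin> F'"
    proof
      assume "v \<in> F'"
      then have "a = v \<or> (a, v) \<in> E" using F by (auto simp: E_iff)
      then show False using E_component \<open>component a = component u\<close> neq by blast
    qed
    then have f: "{a, b, v} \<in> H" using edge_cone[OF F(1-3) H V(2)] by simp
    then have bv: "{b, v} \<in> H" using face_mono by auto
    have "rep a = rep b" using rep_eq_iff[OF H] E_component[OF ab] by simp
    then have "potential a \<otimes> c a b = potential b" by (rule potential_same[OF H])
    then have "potential a \<otimes> c a v = potential b \<otimes> c b v"
      using c_triangle[OF f] abV H bv by (simp add: m_assoc[symmetric] potential_closed c_closed flip: c_triangle[OF f])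
    then show ?case using step.IH by simp
  qed simp
  then show ?thesis
    using potential_rep[OF V(1)] c_closed[OF component_neq_face[of "rep u" v]] V neq by (simp add: rep_in)
qed

lemma c_rep:
  assumes uv: "{u, v} \<in> H"
  shows "potential u \<otimes> c u v \<otimes> inv (potential v) = c (rep u) (rep v)"
proof -
  have V: "u \<in> V" "v \<in> V" using face_subset[OF uv] by auto
  show ?thesis
  proof (cases "rep u = rep v")
    case True
    then show ?thesis using potential_same[OF uv True] V by (simp add: potential_closed c_refl rep_in)
  next
    case False
    then have neq: "component u \<noteq> component v" using rep_eq_iff[OF uv] by simp
    have f: "{rep u, v} \<in> H" "{rep u, rep v} \<in> H"
      using V neq by (auto intro!: component_neq_face simp: rep_in)
    \<comment> \<open>The second argument is moved by exchanging the roles and taking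
      inverses.\<close>
    have "potential v \<otimes> c v (rep u) = c (rep v) (rep u)"
      using V neq by (intro potential_cross) (auto simp: rep_in)
    then have "inv (potential v \<otimes> inv (c (rep u) v)) = inv (inv (c (rep u) (rep v)))"
      using c_sym[OF f(1)] c_sym[OF f(2)] by simp
    then have "c (rep u) v \<otimes> inv (potential v) = c (rep u) (rep v)"
      using f V by (simp add: inv_mult_group potential_closed c_closed)
    then show ?thesis using potential_cross[OF V neq] by simp
  qed
qed

text \<open>A second gauge, along the star at \<open>r\<close>, leaves the value of the triangular
  circuit \<open>r, rep u, rep v, r\<close>. It is the unit when the representatives coincide or one
  of them is \<open>r\<close>.\<close>

lemma c_normal_form:
  assumes r: "r \<in> V" "nontrivial r" "rep r = r" and uv: "{u, v} \<in> H"
  shows "(c r (rep u) \<otimes> potential u) \<otimes> c u v \<otimes> inv (c r (rep v) \<otimes> potential v)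
    = c r (rep u) \<otimes> c (rep u) (rep v) \<otimes> c (rep v) r"
proof -
  have rw: "{r, rep w} \<in> H" if "w \<in> V" for w
  proof (cases "component r = component w")
    case True
    then have "rep w = r" using rep_cong[OF True r(2)] r(3) by simp
    then show ?thesis using vertex_face r by simp
  next
    case False
    then show ?thesis using component_neq_face[of r "rep w"] r(1) that by (simp add: rep_in)
  qed
  have V: "u \<in> V" "v \<in> V" using face_subset[OF uv] by auto
  note cl = potential_closed[OF V(1)] potential_closed[OF V(2)] c_closed[OF uv] c_closed[OF rw[OF V(1)]] c_closed[OF rw[OF V(2)]]
  have "(c r (rep u) \<otimes> potential u) \<otimes> c u v \<otimes> inv (c r (rep v) \<otimes> potential v)
      = c r (rep u) \<otimes> (potential u \<otimes> c u v \<otimes> inv (potential v)) \<otimes> inv (c r (rep v))"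
    using cl by (simp add: inv_mult_group m_assoc)
  then show "(c r (rep u) \<otimes> potential u) \<otimes> c u v \<otimes> inv (c r (rep v) \<otimes> potential v)
    = c r (rep u) \<otimes> c (rep u) (rep v) \<otimes> c (rep v) r"
    using c_rep[OF uv] c_sym[OF rw[OF V(2)]] by simp
qed

end

section \<open>Free groups\<close>

text \<open>Words are evaluated letter by letter; opposite letters have inverse values, so
  cancellation does not matter.\<close>

lemma free_group_lift:
  assumes G: "group G" and f: "\<And>a. a \<in> X \<Longrightarrow> f a \<in> carrier G"
  shows "\<exists>h\<in>hom (free_group X) G. \<forall>a\<in>X. h [(a, True)] = f a \<and> h [(a, False)] = inv\<^bsub>G\<^esub> f a"
proof -
  interpret group G by fact
  define L where "L = (\<lambda>g. if snd g then f (fst g) else inv\<^bsub>G\<^esub> f (fst g))"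
  define ev where "ev = (\<lambda>w. foldr (\<lambda>g z. L g \<otimes>\<^bsub>G\<^esub> z) w \<one>\<^bsub>G\<^esub>)"
  have L: "L g \<in> carrier G" "L (letter_inv g) = inv\<^bsub>G\<^esub> L g" if "fst g \<in> X" for g
    using f[OF that] by (auto simp: L_def letter_inv_def)
  have ev_closed: "ev w \<in> carrier G" if "fst ` set w \<subseteq> X" for w
    using that by (induction w) (auto simp: ev_def L)
  have ev_Cons: "ev (g # w) = L g \<otimes>\<^bsub>G\<^esub> ev w" for g w
    by (simp add: ev_def)
  have ev_cons: "ev (reduced_cons g w) = L g \<otimes>\<^bsub>G\<^esub> ev w"
    if "fst g \<in> X" "fst ` set w \<subseteq> X" for g w
  proof (cases w)
    case Nil
    then show ?thesis by (simp add: ev_Cons)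
  next
    case (Cons h u)
    show ?thesis
    proof (cases "h = letter_inv g")
      case True
      have "L g \<otimes>\<^bsub>G\<^esub> (inv\<^bsub>G\<^esub> L g \<otimes>\<^bsub>G\<^esub> ev u) = ev u"
        using L[OF that(1)] ev_closed[of u] that Cons by (simp add: m_assoc[symmetric])
      then show ?thesis using Cons True L[OF that(1)] by (simp add: ev_Cons)
    qed (simp add: Cons ev_Cons)
  qed
  have ev_mult: "ev (foldr reduced_cons u v) = ev u \<otimes>\<^bsub>G\<^esub> ev v"
    if "fst ` set u \<subseteq> X" "fst ` set v \<subseteq> X" for u v
    using that(1)
  proof (induction u)
    case Nil
    then show ?case using ev_closed[OF that(2)] by (simp add: ev_def)
  next
    case (Cons g u)
    have "fst ` set (foldr reduced_cons u v) \<subseteq> X"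
      using image_mono[OF set_foldr_reduced_cons[of u v], of fst] Cons.prems that(2) by (simp add: image_Un) blast
    then show ?case
      using Cons L ev_closed[of u] ev_closed[OF that(2)] by (simp add: ev_cons ev_Cons m_assoc)
  qed
  have "ev \<in> hom (free_group X) G"
    by (intro homI) (auto simp: free_group_def ev_closed ev_mult)
  moreover have "\<forall>a\<in>X. ev [(a, True)] = f a \<and> ev [(a, False)] = inv\<^bsub>G\<^esub> f a"
    using f by (auto simp: ev_def L_def)
  ultimately show ?thesis by blast
qed

lemma free_group_letter: "a \<in> X \<Longrightarrow> [(a, b)] \<in> carrier (free_group X)"
  by (simp add: free_group_def reduced_word_def)

lemma free_group_letter_inverse:
  "[(a, b)] \<otimes>\<^bsub>free_group X\<^esub> [(a, \<not> b)] = \<one>\<^bsub>free_group X\<^esub>"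
  by (simp add: free_group_def letter_inv_def)

lemma free_group_generated:
  assumes K: "subgroup K (free_group X)" and gen: "\<And>a. a \<in> X \<Longrightarrow> [(a, True)] \<in> K"
  shows "carrier (free_group X) \<subseteq> K"
proof
  interpret group "free_group X" by (rule group_free_group)
  have letter: "[(a, b)] \<in> K" if "a \<in> X" for a b
  proof (cases b)
    case False
    have "inv\<^bsub>free_group X\<^esub> [(a, True)] = [(a, False)]"
      using that free_group_letter_inverse[of X a False] by (intro inv_equality) (auto simp: free_group_letter)
    then show ?thesis using subgroup.m_inv_closed[OF K gen[OF that]] False by simp
  qed (use gen that in simp)
  fix w assume "w \<in> carrier (free_group X)"
  then show "w \<in> K"
  proof (induction w)
    case Nil
    then show ?case using subgroup.one_closed[OF K] by (simp add: free_group_def)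
  next
    case (Cons g w)
    have w: "w \<in> carrier (free_group X)" and g: "fst g \<in> X"
      using Cons.prems by (auto simp: free_group_def reduced_Cons)
    have "g # w = [g] \<otimes>\<^bsub>free_group X\<^esub> w"
      using Cons.prems by (cases w) (auto simp: free_group_def reduced_Cons)
    then show ?case
      using subgroup.m_closed[OF K letter[OF g, of "snd g"] Cons.IH[OF w]] by simp
  qed
qed

section \<open>The fundamental group of a boolean representable complex\<close>

context br_complex
begin

lemma realization_path_exists:
  assumes x: "x \<in> S" and y: "y \<in> S"
  shows "\<exists>p. path_between S x y p"
proof -
  obtain u where u: "u \<in> V" "u \<in> support x" by (rule support_nonempty[OF x])
  obtain v where v: "v \<in> V" "v \<in> support y" by (rule support_nonempty[OF y])
  obtain w where w: "w \<in> V" "{u, w} \<in> H" "{w, v} \<in> H" by (rule edge_path_exists[OF u(1) v(1)])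
  have "path_between S x (vertex_point u) (segment x (vertex_point u))"
    using x u by (intro path_between_segment) (auto simp: vertex_point_in support_face insert_absorb)
  moreover have "path_between S (vertex_point v) y (segment (vertex_point v) y)"
    using y v by (intro path_between_segment) (auto simp: vertex_point_in support_face insert_absorb)
  ultimately show ?thesis
    using path_between_edge[OF w(2)] path_between_edge[OF w(3)] path_between_join by blast
qed

text \<open>The edges, outside a spanning star centred at \<open>r\<close>, of the graph obtained by contracting the
  nontrivial components of the graph of flats.\<close>

definition free_edges :: "'a \<Rightarrow> 'a set set" where
  "free_edges r = {e \<in> nsets (rep ` V - {r}) 2. e \<in> H}"

lemma finite_free_edges: "finite (free_edges r)"
  using finite_V by (simp add: free_edges_def finite_imp_finite_nsets)

lemma free_edges_iff:
  "{a, b} \<in> free_edges r \<longleftrightarrow> a \<noteq> b \<and> {a, b} \<in> H \<and> a \<in> rep ` V \<and> b \<in> rep ` V \<and> a \<noteq> r \<and> b \<noteq> r"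
  by (auto simp: free_edges_def)

lemma fundamental_group_free:
  assumes x: "x \<in> S" and r: "r \<in> V" "nontrivial r" "rep r = r"
  shows "free_of_rank (fundamental_group S x) (card (free_edges r))"
proof -
  define n where "n = card (free_edges r)"
  let ?F = "free_group {..<n}"
  interpret F: group ?F by (rule group_free_group)
  \<comment> \<open>An arbitrary numbering of the vertices orients the edges: the generator runs
    upwards, its inverse downwards.\<close>
  obtain idx :: "'a \<Rightarrow> nat" where idx: "inj_on idx V"
    using finite_imp_inj_to_nat_seg[OF finite_V] by blast
  obtain e :: "'a set \<Rightarrow> nat" where e: "bij_betw e (free_edges r) {..<n}"
    using ex_bij_betw_finite_nat[OF finite_free_edges] by (auto simp: n_def atLeast0LessThan)
  have e_lt: "e {a, b} < n" if "{a, b} \<in> free_edges r" for a b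
    using e that by (auto simp: bij_betw_def)
  have idx_neq: "idx a \<noteq> idx b" if "{a, b} \<in> free_edges r" for a b
    using that inj_onD[OF idx, of a b] rep_in by (auto simp: free_edges_iff)
  define \<gamma> where "\<gamma> = (\<lambda>a b. if {a, b} \<in> free_edges r then [(e {a, b}, idx a < idx b)] else [])"
  define c where "c = (\<lambda>u v. \<gamma> (rep u) (rep v))"
  have \<gamma>_closed: "\<gamma> a b \<in> carrier ?F" for a b
    using e_lt[of a b] by (simp add: \<gamma>_def free_group_def reduced_word_def)
  have \<gamma>_refl: "\<gamma> a a = \<one>\<^bsub>?F\<^esub>" for a
    unfolding \<gamma>_def using free_edges_iff[of a a r] by (simp add: free_group_def)
  have \<gamma>_sym: "\<gamma> a b \<otimes>\<^bsub>?F\<^esub> \<gamma> b a = \<one>\<^bsub>?F\<^esub>" for a b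
  proof (cases "{a, b} \<in> free_edges r")
    case True
    then have "(idx b < idx a) = (\<not> idx a < idx b)" using idx_neq by fastforce
    then show ?thesis
      using True free_group_letter_inverse[of "{..<n}" "e {a, b}" "idx a < idx b"]
      by (simp add: \<gamma>_def insert_commute)
  next
    case False
    then show ?thesis by (simp add: \<gamma>_def insert_commute free_group_def)
  qed
  \<comment> \<open>Two vertices of a face with three vertices have equal representatives, so only
    backtracking has to cancel.\<close>
  have coc: "cocycle V H ?F c"
  proof unfold_locales
    show "c u v \<in> carrier ?F" for u v
      by (simp add: c_def \<gamma>_closed)
    show "c u v \<otimes>\<^bsub>?F\<^esub> c v w = c u w" if "{u, v, w} \<in> H" for u v w
      using face_rep_eq[OF that] by (auto simp: c_def \<gamma>_refl \<gamma>_sym \<gamma>_closed)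
  qed
  obtain \<tau> where \<tau>: "\<And>y. y \<in> S \<Longrightarrow> path_between S x y (\<tau> y)"
    using realization_path_exists[OF x] by metis
  interpret based_complex V H x \<tau>
    using \<tau> x by unfold_locales
  interpret based_cocycle V H x \<tau> ?F c
    using coc by (intro based_cocycle.intro based_complex_axioms)
  \<comment> \<open>The normal form is needed for the tautological cocycle; \<open>c\<close> is
    already in normal form.\<close>
  interpret g: br_cocycle V H G edge_class
    by unfold_locales
  define f where "f = (\<lambda>a b. edge_class r a \<otimes>\<^bsub>G\<^esub> edge_class a b \<otimes>\<^bsub>G\<^esub> edge_class b r)"
  have r_face: "{r, rep u} \<in> H" if "u \<in> V" for u
  proof (cases "component u = component r")
    case True
    then show ?thesis using rep_cong[of r u] r vertex_face by simp
  next
    case False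
    then show ?thesis using that r by (intro component_neq_face) (auto simp: rep_in)
  qed
  have f_closed: "f a b \<in> carrier G" if "{a, b} \<in> free_edges r" for a b
    using that r_face unfolding free_edges_iff f_def
    by (auto intro!: pi1.m_closed edge.c_closed) (metis insert_commute)
  have f_inv: "inv\<^bsub>G\<^esub> f a b = f b a" if "{a, b} \<in> free_edges r" for a b
  proof -
    have H: "{r, a} \<in> H" "{a, r} \<in> H" "{b, r} \<in> H" "{r, b} \<in> H" "{a, b} \<in> H"
      using that r_face by (auto simp: free_edges_iff insert_commute)
    show ?thesis
      unfolding f_def edge.c_sym[OF H(1)] edge.c_sym[OF H(3)] edge.c_sym[OF H(5)] using H
      by (simp add: pi1.inv_mult_group edge.c_closed pi1.m_assoc)
  qed
  have "\<exists>a b. {a, b} \<in> free_edges r \<and> idx a < idx b \<and> e {a, b} = i" if "i < n" for i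
  proof -
    have "i \<in> e ` free_edges r" using e that by (simp add: bij_betw_def)
    then obtain E where E: "E \<in> free_edges r" "e E = i" by auto
    then obtain a b where ab: "E = {a, b}"
      by (auto simp: free_edges_def nsets_def card_2_iff)
    then have "idx a < idx b \<or> idx b < idx a"
      using E idx_neq[of a b] by auto
    then show ?thesis
    proof
      assume "idx a < idx b"
      then show ?thesis using E ab by blast
    next
      assume "idx b < idx a"
      moreover have "E = {b, a}" using ab by (simp add: insert_commute)
      ultimately show ?thesis using E by blast
    qed
  qed
  \<comment> \<open>The oriented end points of the edge that generator \<open>i\<close> stands
    for.\<close>
  then obtain A B where AB: "\<And>i. i < n \<Longrightarrow> {A i, B i} \<in> free_edges r \<and> idx (A i) < idx (B i) \<and> e {A i, B i} = i"
    by metis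
  have AB_unique: "A (e {a, b}) = a \<and> B (e {a, b}) = b" if "{a, b} \<in> free_edges r" "idx a < idx b" for a b
  proof -
    let ?i = "e {a, b}"
    have "{A ?i, B ?i} = {a, b}"
      using AB[OF e_lt[OF that(1)]] that(1) e unfolding bij_betw_def inj_on_def by blast
    then show ?thesis
      using AB[OF e_lt[OF that(1)]] that(2) by (auto simp: doubleton_eq_iff)
  qed
  have "\<exists>h\<in>hom ?F G. \<forall>i\<in>{..<n}. h [(i, True)] = f (A i) (B i) \<and> h [(i, False)] = inv\<^bsub>G\<^esub> f (A i) (B i)"
    using AB f_closed by (intro free_group_lift pi1.is_group) auto
  then obtain h where h: "h \<in> hom ?F G"
    and h_letter: "\<And>i. i < n \<Longrightarrow> h [(i, True)] = f (A i) (B i) \<and> h [(i, False)] = inv\<^bsub>G\<^esub> f (A i) (B i)"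
    by auto
  interpret h: group_hom ?F G h
    using h by unfold_locales
  have h_\<gamma>: "h (\<gamma> a b) = f a b" if "{a, b} \<in> free_edges r" for a b
  proof (cases "idx a < idx b")
    case True
    then show ?thesis using that h_letter[OF e_lt[OF that]] AB_unique[OF that] by (simp add: \<gamma>_def)
  next
    case False
    have ba: "{b, a} \<in> free_edges r" "idx b < idx a" using that idx_neq[OF that] False by (auto simp: insert_commute)
    have "h (\<gamma> a b) = inv\<^bsub>G\<^esub> f b a"
      using that h_letter[OF e_lt[OF that]] AB_unique[OF ba] False by (simp add: \<gamma>_def insert_commute)
    then show ?thesis using f_inv[OF ba(1)] by simp
  qed
  have h_c: "h (c u v) = f (rep u) (rep v)" if "{u, v} \<in> H" for u v
  proof (cases "{rep u, rep v} \<in> free_edges r")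
    case True
    then show ?thesis using h_\<gamma> by (simp add: c_def)
  next
    case False
    have V: "u \<in> V" "v \<in> V" using face_subset[OF that] by auto
    \<comment> \<open>An image edge that is no generator is degenerate or belongs to the star, and
      there both \<open>c\<close> and \<open>f\<close> are trivial.\<close>
    then have "rep u = rep v \<or> rep u = r \<or> rep v = r"
      using False rep_face[OF that] by (auto simp: free_edges_iff)
    moreover have H: "{r, rep u} \<in> H" "{rep u, r} \<in> H" "{r, rep v} \<in> H" "{rep v, r} \<in> H"
      using r_face V by (auto simp: insert_commute)
    ultimately have "f (rep u) (rep v) = \<one>\<^bsub>G\<^esub>"
      using edge.c_sym[OF H(1)] edge.c_sym[OF H(3)] r(1) V
      by (auto simp: f_def edge.c_refl edge.c_closed rep_in)
    then show ?thesis
      using False h.hom_one by (simp add: c_def \<gamma>_def free_group_def)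
  qed
  obtain b where b: "b \<in> V" "b \<in> support x" by (rule support_nonempty[OF x])
  have "G \<cong> ?F"
  proof (rule fundamental_group_iso[OF b(2) h, where k = "\<lambda>v. edge_class r (rep v) \<otimes>\<^bsub>G\<^esub> g.potential v" and A = "(\<lambda>i. [(i, True)]) ` {..<n}"])
    show "edge_class r (rep v) \<otimes>\<^bsub>G\<^esub> g.potential v \<in> carrier G" if "v \<in> V" for v
      using r_face[OF that] g.potential_closed[OF that] by (simp add: edge.c_closed)
    show "h (c u v) = edge_class r (rep u) \<otimes>\<^bsub>G\<^esub> g.potential u \<otimes>\<^bsub>G\<^esub> edge_class u v
        \<otimes>\<^bsub>G\<^esub> inv\<^bsub>G\<^esub> (edge_class r (rep v) \<otimes>\<^bsub>G\<^esub> g.potential v)" if "{u, v} \<in> H" for u v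
      using h_c[OF that] g.c_normal_form[OF r that] by (simp add: f_def)
    show "carrier ?F \<subseteq> K" if "subgroup K ?F" "(\<lambda>i. [(i, True)]) ` {..<n} \<subseteq> K" for K
      using that by (intro free_group_generated) auto
    fix a assume "a \<in> (\<lambda>i. [(i, True)]) ` {..<n}"
    then obtain i where i: "i < n" "a = [(i, True)]" by auto
    define u v where "u = A i" and "v = B i"
    have uv: "{u, v} \<in> free_edges r" "\<gamma> u v = a"
      using AB[OF i(1)] by (auto simp: u_def v_def \<gamma>_def i)
    then have uvH: "{u, v} \<in> H" and uvV: "u \<in> V" "v \<in> V" and uvr: "rep u = u" "rep v = v" "u \<noteq> r" "v \<noteq> r"
      by (auto simp: free_edges_iff rep_in)
    \<comment> \<open>A starting vertex in the component of \<open>r\<close> that spans a face with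
      \<open>b\<close>. If \<open>b\<close> is in that component, it could be parallel to
      \<open>r\<close>, so \<open>b\<close> itself is taken.\<close>
    define b0 where "b0 = (if rep b = r then b else r)"
    have b0: "b0 \<in> V" "rep b0 = r" using b r by (auto simp: b0_def)
    have b0w: "{b0, w} \<in> H" if "w \<in> V" "rep w = w" "w \<noteq> r" for w
    proof (rule component_neq_face[OF b0(1) that(1)])
      have "component b0 = component r" using b0 component_rep[OF b0(1)] by simp
      then show "component b0 \<noteq> component w"
        using rep_cong[of r w] r that by auto
    qed
    have bb0: "{b, b0} \<in> H"
      using r_face[OF b(1)] b r vertex_face component_neq_face[of b r] rep_cong[of r b] by (auto simp: b0_def)
    have trivial: "c y z = \<one>\<^bsub>?F\<^esub>" if "rep y = r \<or> rep z = r" for y z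
      using that by (auto simp: c_def \<gamma>_def free_edges_iff free_group_def)
    have edge_in: "segment (vertex_point y) (vertex_point z) t \<in> S" if "{y, z} \<in> H" "t \<in> {0..1}" for y z t
      using path_between_edge[OF that(1)] that(2) by (rule path_between_in)
    have step: "\<exists>q. path_between S x (vertex_point z) q \<and> holonomy q b z (g' \<otimes>\<^bsub>?F\<^esub> c y z)"
      if p: "path_between S x (vertex_point y) p" "holonomy p b y g'" and yz: "{y, z} \<in> H" for p y z g'
    proof (intro exI conjI)
      let ?q = "segment (vertex_point y) (vertex_point z)"
      show "path_between S x (vertex_point z) (p +++ ?q)"
        using p(1) path_between_edge[OF yz] by (rule path_between_join)
      have "p 1 = ?q 0"
        using p(1) path_between_edge[OF yz] by (simp add: path_between_def pathstart_def pathfinish_def)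
      then show "holonomy (p +++ ?q) b z (g' \<otimes>\<^bsub>?F\<^esub> c y z)"
        using p(2) holonomy_edge[OF yz] edge_in[OF yz] path_between_in[OF p(1)] by (intro holonomy_join) auto
    qed
    have seg: "path_between S x (vertex_point b) (segment x (vertex_point b))"
      "path_between S (vertex_point b) x (segment (vertex_point b) x)"
      using x b by (auto intro!: path_between_segment simp: vertex_point_in support_face insert_absorb)
    have star: "b \<in> support (segment x (vertex_point b) t)" "b \<in> support (segment (vertex_point b) x t)" if "t \<in> {0..1}" for t
    proof -
      have t: "0 \<le> t" "t \<le> 1" and xb: "0 < x b" using that b(2) by (auto simp: support_def)
      have "0 < (1 - t) * x b + t"
        using t xb by (cases "t = 0") (auto intro!: add_nonneg_pos)
      moreover have "0 < (1 - t) + t * x b"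
        using t xb by (cases "t = 1") (auto intro!: add_pos_nonneg)
      ultimately show "b \<in> support (segment x (vertex_point b) t)" "b \<in> support (segment (vertex_point b) x t)"
        by (auto simp: support_def segment_def vertex_point_def)
    qed
    have ends: "segment x (vertex_point b) 0 = x" "segment (vertex_point b) x 0 = vertex_point b"
      by (auto simp: segment_def)
    have "holonomy (segment x (vertex_point b)) b b \<one>\<^bsub>?F\<^esub>"
      using star x ends by (intro holonomy_in_star) auto
    \<comment> \<open>The loop runs through \<open>x, b, b0, u, v, b0, b, x\<close>. Every edge
      other than the one from \<open>u\<close> to \<open>v\<close> has an end over \<open>r\<close>,
      so the holonomy is the generator \<open>a\<close>.\<close>
    from step[OF seg(1) this bb0] obtain p1 where p1: "path_between S x (vertex_point b0) p1" "holonomy p1 b b0 \<one>\<^bsub>?F\<^esub>"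
      using trivial b0 by auto
    from step[OF p1 b0w[OF uvV(1) uvr(1,3)]] obtain p2 where p2: "path_between S x (vertex_point u) p2" "holonomy p2 b u \<one>\<^bsub>?F\<^esub>"
      using trivial b0 by auto
    from step[OF p2 uvH] obtain p3 where p3: "path_between S x (vertex_point v) p3" "holonomy p3 b v a"
      using uv(2) uvr \<gamma>_closed[of u v] by (auto simp: c_def)
    have a: "a \<in> carrier ?F" using uv(2) \<gamma>_closed by auto
    have "{v, b0} \<in> H" using b0w[OF uvV(2) uvr(2,4)] by (simp add: insert_commute)
    from step[OF p3 this] obtain p4 where p4: "path_between S x (vertex_point b0) p4" "holonomy p4 b b0 a"
      using trivial b0 a by auto
    have "{b0, b} \<in> H" using bb0 by (simp add: insert_commute)
    from step[OF p4 this] obtain p5 where p5: "path_between S x (vertex_point b) p5" "holonomy p5 b b a"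
      using trivial b0 a by auto
    have "holonomy (p5 +++ segment (vertex_point b) x) b b (a \<otimes>\<^bsub>?F\<^esub> \<one>\<^bsub>?F\<^esub>)"
    proof (rule holonomy_join[OF _ p5(2)])
      show "p5 t \<in> S" if "t \<in> {0..1}" for t using path_between_in[OF p5(1) that] .
      show "segment (vertex_point b) x t \<in> S" if "t \<in> {0..1}" for t using path_between_in[OF seg(2) that] .
      show "holonomy (segment (vertex_point b) x) b b \<one>\<^bsub>?F\<^esub>"
        using star vertex_point_in[OF b(1)] ends by (intro holonomy_in_star) auto
      show "p5 1 = segment (vertex_point b) x 0"
        using p5(1) ends by (simp add: path_between_def pathfinish_def)
    qed
    then show "\<exists>p\<in>loops_at S x. holonomy p b b a"
      using path_between_join[OF p5(1) seg(2)] a by (auto simp: loops_at_path_between)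
  qed
  then show ?thesis
    by (simp add: free_of_rank_def n_def)
qed

section \<open>The rank\<close>

lemma components_eq: "flat_graph_components V H = component ` V"
  by (auto simp: flat_graph_components_def quotient_def component_def)

lemma trivial_component_iff: "C \<in> trivial_components V H \<longleftrightarrow> (\<exists>u\<in>V. \<not> nontrivial u \<and> C = component u)"
  by (auto simp: trivial_components_def components_eq nontrivial_def)

lemma nontrivial_component_iff: "C \<in> nontrivial_components V H \<longleftrightarrow> (\<exists>u\<in>V. nontrivial u \<and> C = component u)"
  by (auto simp: nontrivial_components_def components_eq nontrivial_def)

lemma finite_component: "finite (component u)"
  using finite_V by (simp add: component_def)

lemma disjoint_trivial_components:
  assumes "C \<in> trivial_components V H" "D \<in> trivial_components V H" "C \<noteq> D"
  shows "C \<inter> D = {}"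
proof (rule ccontr)
  assume "C \<inter> D \<noteq> {}"
  then obtain u where "u \<in> C" "u \<in> D" by blast
  moreover obtain v w where "C = component v" "D = component w"
    using assms(1,2) by (auto simp: trivial_component_iff)
  ultimately show False
    using component_eq[of u v] component_eq[of u w] assms(3) by simp
qed

lemma finite_trivial_components: "finite (trivial_components V H)"
  using finite_V by (simp add: trivial_components_def components_eq)

lemma Union_trivial_components: "\<Union>(trivial_components V H) = {u \<in> V. \<not> nontrivial u}"
proof -
  have "v \<in> V \<and> \<not> nontrivial v" if "v \<in> component u" "\<not> nontrivial u" for u v
  proof -
    have "v \<in> V" using that(1) by (simp add: component_def)
    then show ?thesis using nontrivial_cong[OF component_eq[OF that(1)]] that(2) by simp
  qed
  moreover have "u \<in> \<Union>(trivial_components V H)" if "u \<in> V" "\<not> nontrivial u" for u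
    using that component_refl[OF that(1)] trivial_component_iff by blast
  ultimately show ?thesis
    by (auto simp: trivial_component_iff)
qed

lemma card_reps:
  "card (rep ` V) = card (nontrivial_components V H) + (\<Sum>C\<in>trivial_components V H. card C)"
proof -
  define N T where "N = {u \<in> V. nontrivial u}" and "T = {u \<in> V. \<not> nontrivial u}"
  have fin: "finite N" "finite T" using finite_V by (auto simp: N_def T_def)
  have "rep u = u" if "u \<in> T" for u using that by (simp add: T_def rep_def)
  then have "rep ` T = T" by force
  moreover have "V = N \<union> T" by (auto simp: N_def T_def)
  ultimately have "rep ` V = rep ` N \<union> T" by (simp add: image_Un)
  moreover have "nontrivial (rep u)" if "u \<in> N" for u
    using that nontrivial_cong[of "rep u" u] by (auto simp: N_def)
  then have "rep ` N \<inter> T = {}" by (auto simp: T_def)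
  ultimately have "card (rep ` V) = card (rep ` N) + card T"
    using fin by (simp add: card_Un_disjoint)
  moreover have "bij_betw component (rep ` N) (nontrivial_components V H)"
  proof (rule bij_betw_imageI)
    show "inj_on component (rep ` N)"
      by (rule inj_onI) (auto simp: N_def intro: rep_cong)
    show "component ` rep ` N = nontrivial_components V H"
      unfolding image_image by (auto simp: N_def nontrivial_component_iff)
  qed
  then have "card (rep ` N) = card (nontrivial_components V H)" by (rule bij_betw_same_card)
  moreover have "card (\<Union>(trivial_components V H)) = (\<Sum>C\<in>trivial_components V H. card C)"
  proof (rule card_Union_disjoint)
    show "pairwise disjnt (trivial_components V H)"
      using disjoint_trivial_components by (simp add: pairwise_def disjnt_def)
  qed (auto simp: trivial_component_iff finite_component)
  then have "card T = (\<Sum>C\<in>trivial_components V H. card C)"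
    by (simp add: Union_trivial_components T_def)
  ultimately show ?thesis by simp
qed

text \<open>Among the representatives other than \<open>r\<close>, the pairs that are no faces are
  exactly the pairs within a trivial component: distinct components always yield faces, and a
  nontrivial component has only one representative.\<close>

lemma card_free_edges:
  assumes r: "r \<in> V" "nontrivial r" "rep r = r"
  shows "card (free_edges r) + (\<Sum>C\<in>trivial_components V H. card C choose 2) = (card (rep ` V) - 1) choose 2"
proof -
  define T where "T = (\<Union>C\<in>trivial_components V H. nsets C 2)"
  have "nsets (rep ` V - {r}) 2 = free_edges r \<union> T"
  proof (intro equalityI subsetI)
    fix e assume e: "e \<in> nsets (rep ` V - {r}) 2"
    then obtain a b where ab: "e = {a, b}" "a \<noteq> b" "a \<in> rep ` V" "b \<in> rep ` V"
      by (auto simp: nsets_def card_2_iff)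
    then have V: "a \<in> V" "b \<in> V" "rep a = a" "rep b = b" by (auto simp: rep_in)
    show "e \<in> free_edges r \<union> T"
    proof (cases "e \<in> H")
      case False
      then have "component a = component b" using component_neq_face V ab by blast
      then have "\<not> nontrivial a" using rep_cong V ab by metis
      moreover have "e \<in> nsets (component a) 2"
        using ab V component_refl \<open>component a = component b\<close> by auto
      moreover have "component a \<in> trivial_components V H"
        using V calculation(1) trivial_component_iff by blast
      ultimately show ?thesis by (auto simp: T_def)
    qed (use e in \<open>simp add: free_edges_def\<close>)
  next
    fix e assume "e \<in> free_edges r \<union> T"
    then show "e \<in> nsets (rep ` V - {r}) 2"
    proof
      assume "e \<in> T"
      then obtain C where C: "C \<in> trivial_components V H" "e \<in> nsets C 2" by (auto simp: T_def)
      have "u \<in> rep ` V - {r}" if "u \<in> C" for u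
      proof -
        have "u \<in> V" "\<not> nontrivial u" using that C(1) Union_trivial_components by auto
        then have "u = rep u" "u \<noteq> r" using r by (auto simp: rep_def)
        then show ?thesis using \<open>u \<in> V\<close> by blast
      qed
      then show ?thesis using C(2) by (auto simp: nsets_def)
    qed (simp add: free_edges_def)
  qed
  moreover have "free_edges r \<inter> T = {}"
    by (auto simp: free_edges_def T_def trivial_components_def)
  moreover have "finite T"
    using finite_trivial_components by (auto simp: T_def trivial_component_iff finite_component intro!: finite_imp_finite_nsets)
  ultimately have "card (nsets (rep ` V - {r}) 2) = card (free_edges r) + card T"
    using finite_free_edges by (simp add: card_Un_disjoint)
  moreover have "card T = (\<Sum>C\<in>trivial_components V H. card (nsets C 2))"
    unfolding T_def
  proof (rule card_UN_disjoint)
    show "\<forall>C\<in>trivial_components V H. \<forall>D\<in>trivial_components V H. C \<noteq> D \<longrightarrow> nsets C 2 \<inter> nsets D 2 = {}"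
    proof (intro ballI impI)
      fix C D assume "C \<in> trivial_components V H" "D \<in> trivial_components V H" "C \<noteq> D"
      then have "C \<inter> D = {}" by (rule disjoint_trivial_components)
      moreover have "x \<noteq> {}" if "x \<in> nsets C 2" for x
        using that by (auto simp: nsets_def)
      ultimately show "nsets C 2 \<inter> nsets D 2 = {}"
        unfolding nsets_def by blast
    qed
  qed (auto simp: finite_trivial_components trivial_component_iff finite_component intro!: finite_imp_finite_nsets)
  moreover have "card (rep ` V - {r}) = card (rep ` V) - 1"
    using r finite_V by (intro card_Diff_singleton) (metis imageI)
  ultimately show ?thesis
    by (simp add: card_nsets)
qed

end

section \<open>Binomial identities and the rank formula\<close>

lemma gbinomial_two: "(x :: real) gchoose 2 = x * (x - 1) / 2"
  by (simp add: gbinomial_prod_rev numeral_2_eq_2)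

lemma square_sum_pairs:
  fixes f :: "nat \<Rightarrow> real"
  shows "(\<Sum>i=1..r. f i)\<^sup>2 = (\<Sum>i=1..r. (f i)\<^sup>2) + 2 * (\<Sum>(i, j)\<in>{(i, j). 1 \<le> i \<and> i < j \<and> j \<le> r}. f i * f j)"
proof (induction r)
  case 0
  have "{(i, j). 1 \<le> i \<and> i < j \<and> j \<le> (0::nat)} = {}" by auto
  then show ?case by (simp only:) simp
next
  case (Suc r)
  let ?P = "\<lambda>r::nat. {(i, j). 1 \<le> i \<and> i < j \<and> j \<le> r}"
  have "?P (Suc r) = ?P r \<union> (\<lambda>i. (i, Suc r)) ` {1..r}" by auto
  moreover have "finite (?P r)" by (rule finite_subset[of _ "{..r} \<times> {..r}"]) auto
  moreover have "?P r \<inter> (\<lambda>i. (i, Suc r)) ` {1..r} = {}" by auto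
  ultimately have "(\<Sum>(i, j)\<in>?P (Suc r). f i * f j)
      = (\<Sum>(i, j)\<in>?P r. f i * f j) + (\<Sum>(i, j)\<in>(\<lambda>i. (i, Suc r)) ` {1..r}. f i * f j)"
    by (simp add: sum.union_disjoint)
  also have "(\<Sum>(i, j)\<in>(\<lambda>i. (i, Suc r)) ` {1..r}. f i * f j) = (\<Sum>i=1..r. f i) * f (Suc r)"
    by (subst sum.reindex) (auto simp: inj_on_def sum_distrib_right)
  finally show ?case
    using Suc.IH by (simp add: power2_eq_square algebra_simps)
qed

theorem theorem3p3:
  fixes V :: "'a set" and H :: "'a set set"
    and s r :: nat and C :: "nat \<Rightarrow> 'a set" and f :: "nat \<Rightarrow> nat"
  assumes "abstract_complex V H"
    and "boolean_representable V H"
    and "complex_dim H \<ge> 2"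
    and "s = card (nontrivial_components V H)"
    and "bij_betw C {1..r} (trivial_components V H)"
    and "\<And>i. i \<in> {1..r} \<Longrightarrow> f i = card (C i)"
  shows "\<exists>n::nat.
    (\<forall>x\<in>geometric_realization V H.
       free_of_rank (fundamental_group (geometric_realization V H) x) n) \<and>
    real n = ((real s + (\<Sum>i=1..r. real (f i)) - 1) gchoose 2) - (\<Sum>i=1..r. real (f i choose 2)) \<and>
    real n = ((real s - 1) gchoose 2) + (real s - 1) * (\<Sum>i=1..r. real (f i))
             + (\<Sum>(i, j)\<in>{(i, j). 1 \<le> i \<and> i < j \<and> j \<le> r}. real (f i) * real (f j))"
proof -
  have "finite H" "H \<noteq> {}"
    using assms(1) by (auto simp: abstract_complex_def intro: finite_subset)
  then have "complex_dim H \<in> (\<lambda>I. int (card I) - 1) ` H"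
    unfolding complex_dim_def by (intro Max_in) auto
  then have "\<exists>X\<in>H. 3 \<le> card X"
    using assms(3) by force
  then interpret br_complex V H
    using assms(1,2) by unfold_locales
  obtain u where u: "u \<in> V" "nontrivial u" using nontrivial_exists by blast
  define v where "v = rep u"
  have v: "v \<in> V" "nontrivial v" "rep v = v"
    using u nontrivial_cong[of "rep u" u] by (auto simp: v_def rep_in)
  define n where "n = card (free_edges v)"
  define \<sigma> where "\<sigma> = (\<Sum>i=1..r. real (f i))"
  have reindex: "(\<Sum>C\<in>trivial_components V H. g (card C)) = (\<Sum>i=1..r. g (f i))" for g :: "nat \<Rightarrow> nat"
    using sum.reindex_bij_betw[OF assms(5), of "\<lambda>C. g (card C)"] assms(6) by simp
  have reps: "card (rep ` V) = s + (\<Sum>i=1..r. f i)"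
    using card_reps reindex[of "\<lambda>k. k"] assms(4) by simp
  \<comment> \<open>Positivity makes the truncated subtraction of 1 agree with the real one.\<close>
  moreover have "0 < card (rep ` V)"
    using u finite_V by (auto simp: card_gt_0_iff)
  ultimately have m: "real (card (rep ` V) - 1) = real s + \<sigma> - 1"
    by (simp add: \<sigma>_def of_nat_diff Suc_leI flip: of_nat_sum)
  have "real n + (\<Sum>i=1..r. real (f i choose 2)) = real ((card (rep ` V) - 1) choose 2)"
    using card_free_edges[OF v] reindex[of "\<lambda>k. k choose 2"] by (simp add: n_def flip: of_nat_sum of_nat_add)
  also have "\<dots> = (real s + \<sigma> - 1) gchoose 2"
    unfolding binomial_gbinomial m ..
  finally have 1: "real n = ((real s + \<sigma> - 1) gchoose 2) - (\<Sum>i=1..r. real (f i choose 2))"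
    by simp
  \<comment> \<open>With every binomial written as a quadratic, the two rank formulas differ by the
    expansion of \<open>\<sigma>\<close> squared into squares and mixed products.\<close>
  have "real (f i choose 2) = ((real (f i))\<^sup>2 - real (f i)) / 2" for i
    by (simp add: binomial_gbinomial gbinomial_two power2_eq_square algebra_simps)
  then have "(\<Sum>i=1..r. real (f i choose 2)) = ((\<Sum>i=1..r. (real (f i))\<^sup>2) - \<sigma>) / 2"
    by (simp only: \<sigma>_def sum_subtractf sum_divide_distrib[symmetric])
  then have 2: "real n = ((real s - 1) gchoose 2) + (real s - 1) * \<sigma>
      + (\<Sum>(i, j)\<in>{(i, j). 1 \<le> i \<and> i < j \<and> j \<le> r}. real (f i) * real (f j))"
    using 1 square_sum_pairs[of "\<lambda>i. real (f i)" r]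
    unfolding \<sigma>_def[symmetric] gbinomial_two by (simp add: power2_eq_square field_simps)
  show ?thesis
    using fundamental_group_free[OF _ v] 1 2 unfolding n_def[symmetric] \<sigma>_def by blast
qed

end
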